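(* Let $K$ and $S$ be Kleene algebras that are Morita-equivalent as Kleene algebras. Then there are a positive integer $n$ and a full multiplicative idempotent $e$ in the semiring $M$ of $n\times n$ matrices over $K$ such that $S\cong eMe$ as semirings.
   Context: A semiring $\langle S,+,\cdot,0,1\rangle$ is unital: $\langle S,+,0\rangle$ is a commutative monoid, $\langle S,\cdot,1\rangle$ is a monoid, $s0=0s=0$ for all $s$, and multiplication distributes over addition on both sides. A left module over a semiring $S$ is a commutative monoid $\langle M,+,0\rangle$ with a map $S\times M\to M$ satisfying $s(m+n)=sm+sn$, $(s+t)m=sm+tm$, $s(tm)=(st)m$, $1m=m$, $0m=0$; right modules are defined symmetrically. An $(S,T)$-bimodule is a left $S$-module and right $T$-module on the same commutative monoid with $s(mt)=(sm)t$. Homomorphisms are maps preserving addition and the scalar action(s); isomorphisms are invertible homomorphisms. A Kleene algebra is an additively idempotent semiring $K$ ($x+x=x$), ordered by $x\le y\iff x+y=y$, with a unary operation $*$ such that for all $x,y,z$: $1+xx^*=1+x^*x=x^*$; if $x+yz\le z$ then $y^*x\le z$; if $x+zy\le z$ then $xy^*\le z$. A left Kleene module over $K$ is a left module $M$ over the semiring reduct of $K$ such that $am\le m\Rightarrow a^*m\le m$ for all $a\in K$, $m\in M$ (where $x\le y\iff x+y=y$); a right Kleene module is defined symmetrically ($ma\le m\Rightarrow ma^*\le m$). A Kleene $(K,L)$-bimodule is a semiring $(K,L)$-bimodule that is both a left Kleene module over $K$ and a right Kleene module over $L$. Tensor product: for an $(A,B)$-bimodule $X$ and a $(B,C)$-bimodule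 $Y$, $X\otimes_B Y$ is the quotient of the commutative monoid of finite formal sums of pairs $(x,y)\in X\times Y$ by the least congruence under which the class $x\otimes y$ of $(x,y)$ is additive in each variable (with $0\otimes y=x\otimes 0=0$) and $B$-balanced, $xb\otimes y=x\otimes by$; it is an $(A,C)$-bimodule via $a(x\otimes y)=(ax)\otimes y$ and $(x\otimes y)c=x\otimes(yc)$. Kleene algebras $K$ and $S$ are Morita-equivalent as Kleene algebras if there are a Kleene $(K,S)$-bimodule $X$ and a Kleene $(S,K)$-bimodule $Y$ with $X\otimes_S Y\cong {}_KK_K$ and $Y\otimes_K X\cong {}_SS_S$ as bimodules, where ${}_KK_K$ is $K$ as a bimodule over itself by multiplication. An element $e$ of a semiring $R$ is multiplicatively idempotent if $e^2=e$, and full if $ReR=R$, where $ReR$ is the set of finite sums of elements $res$ with $r,s\in R$. For an idempotent $e\in R$, $eRe=\{ere: r\in R\}$ is a semiring with the operations of $R$ and multiplicative identity $e$. *)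

theory Defs
  imports
    "HOL-Algebra.QuotRing"
    "HOL-Library.Multiset"
    "Jordan_Normal_Form.Matrix"
begin

section \<open>Kleene algebras\<close>

text \<open>
  Semirings are those of the locale \<^locale>\<open>semiring\<close>: unital, with absorbing zero, not necessarily
  commutative; zero and one may coincide.
\<close>

definition add_le :: "('a, 'm) ring_scheme \<Rightarrow> 'a \<Rightarrow> 'a \<Rightarrow> bool" (infix \<open>\<preceq>\<index>\<close> 50) where
  "x \<preceq>\<^bsub>R\<^esub> y \<longleftrightarrow> x \<oplus>\<^bsub>R\<^esub> y = y"

record 'a kleene = "'a ring" +
  star :: "'a \<Rightarrow> 'a"

locale kleene_algebra = semiring K for K :: "('a, 'm) kleene_scheme" (structure) +
  assumes add_idem: "x \<in> carrier K \<Longrightarrow> x \<oplus> x = x"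
    and star_closed: "x \<in> carrier K \<Longrightarrow> star K x \<in> carrier K"
    and star_unfold_left: "x \<in> carrier K \<Longrightarrow> \<one> \<oplus> x \<otimes> star K x = star K x"
    and star_unfold_right: "x \<in> carrier K \<Longrightarrow> \<one> \<oplus> star K x \<otimes> x = star K x"
    and star_induct_left:
      "\<lbrakk>x \<in> carrier K; y \<in> carrier K; z \<in> carrier K; x \<oplus> y \<otimes> z \<preceq> z\<rbrakk> \<Longrightarrow> star K y \<otimes> x \<preceq> z"
    and star_induct_right:
      "\<lbrakk>x \<in> carrier K; y \<in> carrier K; z \<in> carrier K; x \<oplus> z \<otimes> y \<preceq> z\<rbrakk> \<Longrightarrow> x \<otimes> star K y \<preceq> z"

section \<open>Modules and bimodules\<close>

text \<open>
  As in the record \<^typ>\<open>('a, 'b) module\<close> of HOL-Algebra, the additive monoid is carried by a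
  \<^typ>\<open>'x ring\<close> record whose fields \<^const>\<open>monoid.mult\<close> and \<^const>\<open>monoid.one\<close> are irrelevant. One record type
  serves for left modules, right modules and bimodules; a one-sided notion ignores the other action.
\<close>

record ('a, 'b, 'x) bimodule = "'x ring" +
  lact :: "'a \<Rightarrow> 'x \<Rightarrow> 'x" (infixr \<open>\<rightharpoonup>\<index>\<close> 72)
  ract :: "'x \<Rightarrow> 'b \<Rightarrow> 'x" (infixl \<open>\<leftharpoonup>\<index>\<close> 72)

locale left_semimodule = A: semiring A + X: abelian_monoid X
  for A :: "('a, 'm) ring_scheme" and X :: "('a, 'b, 'x, 'n) bimodule_scheme" (structure) +
  assumes lact_closed: "\<lbrakk>a \<in> carrier A; x \<in> carrier X\<rbrakk> \<Longrightarrow> a \<rightharpoonup> x \<in> carrier X"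
    and lact_add_right: "\<lbrakk>a \<in> carrier A; x \<in> carrier X; y \<in> carrier X\<rbrakk> \<Longrightarrow>
      a \<rightharpoonup> (x \<oplus> y) = (a \<rightharpoonup> x) \<oplus> (a \<rightharpoonup> y)"
    and lact_add_left: "\<lbrakk>a \<in> carrier A; a' \<in> carrier A; x \<in> carrier X\<rbrakk> \<Longrightarrow>
      (a \<oplus>\<^bsub>A\<^esub> a') \<rightharpoonup> x = (a \<rightharpoonup> x) \<oplus> (a' \<rightharpoonup> x)"
    and lact_mult: "\<lbrakk>a \<in> carrier A; a' \<in> carrier A; x \<in> carrier X\<rbrakk> \<Longrightarrow>
      a \<rightharpoonup> (a' \<rightharpoonup> x) = (a \<otimes>\<^bsub>A\<^esub> a') \<rightharpoonup> x"
    and lact_one: "x \<in> carrier X \<Longrightarrow> \<one>\<^bsub>A\<^esub> \<rightharpoonup> x = x"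
    and lact_zero: "x \<in> carrier X \<Longrightarrow> \<zero>\<^bsub>A\<^esub> \<rightharpoonup> x = \<zero>"

locale right_semimodule = B: semiring B + X: abelian_monoid X
  for B :: "('b, 'm) ring_scheme" and X :: "('a, 'b, 'x, 'n) bimodule_scheme" (structure) +
  assumes ract_closed: "\<lbrakk>b \<in> carrier B; x \<in> carrier X\<rbrakk> \<Longrightarrow> x \<leftharpoonup> b \<in> carrier X"
    and ract_add_left: "\<lbrakk>b \<in> carrier B; x \<in> carrier X; y \<in> carrier X\<rbrakk> \<Longrightarrow>
      (x \<oplus> y) \<leftharpoonup> b = (x \<leftharpoonup> b) \<oplus> (y \<leftharpoonup> b)"
    and ract_add_right: "\<lbrakk>b \<in> carrier B; b' \<in> carrier B; x \<in> carrier X\<rbrakk> \<Longrightarrow>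
      x \<leftharpoonup> (b \<oplus>\<^bsub>B\<^esub> b') = (x \<leftharpoonup> b) \<oplus> (x \<leftharpoonup> b')"
    and ract_mult: "\<lbrakk>b \<in> carrier B; b' \<in> carrier B; x \<in> carrier X\<rbrakk> \<Longrightarrow>
      (x \<leftharpoonup> b) \<leftharpoonup> b' = x \<leftharpoonup> (b \<otimes>\<^bsub>B\<^esub> b')"
    and ract_one: "x \<in> carrier X \<Longrightarrow> x \<leftharpoonup> \<one>\<^bsub>B\<^esub> = x"
    and ract_zero: "x \<in> carrier X \<Longrightarrow> x \<leftharpoonup> \<zero>\<^bsub>B\<^esub> = \<zero>"

locale semibimodule = left_semimodule A X + right_semimodule B X
  for A :: "('a, 'm) ring_scheme" and B :: "('b, 'p) ring_scheme"
    and X :: "('a, 'b, 'x, 'n) bimodule_scheme" (structure) +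
  assumes act_assoc: "\<lbrakk>a \<in> carrier A; b \<in> carrier B; x \<in> carrier X\<rbrakk> \<Longrightarrow>
    a \<rightharpoonup> (x \<leftharpoonup> b) = (a \<rightharpoonup> x) \<leftharpoonup> b"

locale left_kleene_module = K: kleene_algebra K + left_semimodule K X
  for K :: "('a, 'm) kleene_scheme" and X :: "('a, 'b, 'x, 'n) bimodule_scheme" (structure) +
  assumes lact_star:
    "\<lbrakk>a \<in> carrier K; x \<in> carrier X; a \<rightharpoonup> x \<preceq> x\<rbrakk> \<Longrightarrow> star K a \<rightharpoonup> x \<preceq> x"

locale right_kleene_module = L: kleene_algebra L + right_semimodule L X
  for L :: "('b, 'm) kleene_scheme" and X :: "('a, 'b, 'x, 'n) bimodule_scheme" (structure) +
  assumes ract_star: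
    "\<lbrakk>b \<in> carrier L; x \<in> carrier X; x \<leftharpoonup> b \<preceq> x\<rbrakk> \<Longrightarrow> x \<leftharpoonup> star L b \<preceq> x"

locale kleene_bimodule = semibimodule K L X + left_kleene_module K X + right_kleene_module L X
  for K :: "('a, 'm) kleene_scheme" and L :: "('b, 'p) kleene_scheme"
    and X :: "('a, 'b, 'x, 'n) bimodule_scheme" (structure)

definition regular_bimodule :: "('a, 'm) ring_scheme \<Rightarrow> ('a, 'a, 'a) bimodule" where
  "regular_bimodule R =
    \<lparr>carrier = carrier R, monoid.mult = monoid.mult R, one = \<one>\<^bsub>R\<^esub>, zero = \<zero>\<^bsub>R\<^esub>, add = add R,
     lact = monoid.mult R, ract = monoid.mult R\<rparr>"

lemma regular_kleene_bimodule:
  fixes K (structure)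
  assumes "kleene_algebra K"
  shows "kleene_bimodule K K (regular_bimodule K)"
proof -
  interpret kleene_algebra K by fact
  have "abelian_monoid (regular_bimodule K)"
    by (rule abelian_monoidI) (auto simp: regular_bimodule_def a_ac)
  then interpret X: abelian_monoid "regular_bimodule K" .
  have star_left: "star K a \<otimes> x \<preceq> x"
    if "a \<in> carrier K" "x \<in> carrier K" "a \<otimes> x \<preceq> x" for a x
  proof -
    have "x \<oplus> a \<otimes> x = x" using that by (simp add: add_le_def a_comm)
    with that show ?thesis using star_induct_left[of x a x] add_idem[of x] by (simp add: add_le_def)
  qed
  have star_right: "x \<otimes> star K a \<preceq> x"
    if "a \<in> carrier K" "x \<in> carrier K" "x \<otimes> a \<preceq> x" for a x
  proof -
    have "x \<oplus> x \<otimes> a = x" using that by (simp add: add_le_def a_comm)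
    with that show ?thesis using star_induct_right[of x a x] add_idem[of x] by (simp add: add_le_def)
  qed
  show ?thesis
    by unfold_locales
      (use star_left star_right in
        \<open>auto simp: regular_bimodule_def l_distr r_distr m_assoc add_le_def\<close>)
qed

definition bimodule_hom ::
  "('a, 'm) ring_scheme \<Rightarrow> ('b, 'p) ring_scheme \<Rightarrow> ('a, 'b, 'x, 'n) bimodule_scheme \<Rightarrow>
   ('a, 'b, 'y, 'q) bimodule_scheme \<Rightarrow> ('x \<Rightarrow> 'y) set" where
  "bimodule_hom A B X Y = {h. h \<in> carrier X \<rightarrow> carrier Y \<and>
    (\<forall>x \<in> carrier X. \<forall>x' \<in> carrier X. h (x \<oplus>\<^bsub>X\<^esub> x') = h x \<oplus>\<^bsub>Y\<^esub> h x') \<and>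
    (\<forall>a \<in> carrier A. \<forall>x \<in> carrier X. h (a \<rightharpoonup>\<^bsub>X\<^esub> x) = a \<rightharpoonup>\<^bsub>Y\<^esub> h x) \<and>
    (\<forall>b \<in> carrier B. \<forall>x \<in> carrier X. h (x \<leftharpoonup>\<^bsub>X\<^esub> b) = h x \<leftharpoonup>\<^bsub>Y\<^esub> b)}"

definition bimodule_iso ::
  "('a, 'm) ring_scheme \<Rightarrow> ('b, 'p) ring_scheme \<Rightarrow> ('a, 'b, 'x, 'n) bimodule_scheme \<Rightarrow>
   ('a, 'b, 'y, 'q) bimodule_scheme \<Rightarrow> ('x \<Rightarrow> 'y) set" where
  "bimodule_iso A B X Y = {h \<in> bimodule_hom A B X Y. bij_betw h (carrier X) (carrier Y)}"

section \<open>Tensor product\<close>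

text \<open>Finite formal sums of pairs, i.e. the free commutative monoid on the set of pairs.\<close>

definition formal_sums ::
  "('a, 'b, 'x, 'm) bimodule_scheme \<Rightarrow> ('b, 'c, 'y, 'n) bimodule_scheme \<Rightarrow> ('x \<times> 'y) multiset set"
  where "formal_sums X Y = {u. set_mset u \<subseteq> carrier X \<times> carrier Y}"

inductive_set tensor_cong ::
  "('a, 'b, 'x, 'm) bimodule_scheme \<Rightarrow> ('b, 'p) ring_scheme \<Rightarrow>
   ('b, 'c, 'y, 'n) bimodule_scheme \<Rightarrow> (('x \<times> 'y) multiset \<times> ('x \<times> 'y) multiset) set"
  for X :: "('a, 'b, 'x, 'm) bimodule_scheme" and B :: "('b, 'p) ring_scheme"
    and Y :: "('b, 'c, 'y, 'n) bimodule_scheme"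
  where
    refl: "u \<in> formal_sums X Y \<Longrightarrow> (u, u) \<in> tensor_cong X B Y"
  | sym: "(u, v) \<in> tensor_cong X B Y \<Longrightarrow> (v, u) \<in> tensor_cong X B Y"
  | trans: "\<lbrakk>(u, v) \<in> tensor_cong X B Y; (v, w) \<in> tensor_cong X B Y\<rbrakk> \<Longrightarrow>
      (u, w) \<in> tensor_cong X B Y"
  | plus: "\<lbrakk>(u, v) \<in> tensor_cong X B Y; (u', v') \<in> tensor_cong X B Y\<rbrakk> \<Longrightarrow>
      (u + u', v + v') \<in> tensor_cong X B Y"
  | add_left: "\<lbrakk>x \<in> carrier X; x' \<in> carrier X; y \<in> carrier Y\<rbrakk> \<Longrightarrow>
      ({#(x \<oplus>\<^bsub>X\<^esub> x', y)#}, {#(x, y), (x', y)#}) \<in> tensor_cong X B Y"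
  | add_right: "\<lbrakk>x \<in> carrier X; y \<in> carrier Y; y' \<in> carrier Y\<rbrakk> \<Longrightarrow>
      ({#(x, y \<oplus>\<^bsub>Y\<^esub> y')#}, {#(x, y), (x, y')#}) \<in> tensor_cong X B Y"
  | zero_left: "y \<in> carrier Y \<Longrightarrow> ({#(\<zero>\<^bsub>X\<^esub>, y)#}, {#}) \<in> tensor_cong X B Y"
  | zero_right: "x \<in> carrier X \<Longrightarrow> ({#(x, \<zero>\<^bsub>Y\<^esub>)#}, {#}) \<in> tensor_cong X B Y"
  | balanced: "\<lbrakk>x \<in> carrier X; b \<in> carrier B; y \<in> carrier Y\<rbrakk> \<Longrightarrow>
      ({#(x \<leftharpoonup>\<^bsub>X\<^esub> b, y)#}, {#(x, b \<rightharpoonup>\<^bsub>Y\<^esub> y)#}) \<in> tensor_cong X B Y"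

text \<open>
  Operations on congruence classes are unions over representatives, as usual for
  \<^const>\<open>quotient\<close>; they are well defined, see
  \<open>semibimodule_tensor\<close> below.
\<close>

definition tensor ::
  "('a, 'b, 'x, 'm) bimodule_scheme \<Rightarrow> ('b, 'p) ring_scheme \<Rightarrow>
   ('b, 'c, 'y, 'n) bimodule_scheme \<Rightarrow> ('a, 'c, ('x \<times> 'y) multiset set) bimodule" where
  "tensor X B Y =
    \<lparr>carrier = formal_sums X Y // tensor_cong X B Y,
     monoid.mult = undefined,
     one = undefined,
     zero = tensor_cong X B Y `` {{#}},
     add = (\<lambda>P Q. \<Union>u \<in> P. \<Union>v \<in> Q. tensor_cong X B Y `` {u + v}),
     lact = (\<lambda>a P. \<Union>u \<in> P. tensor_cong X B Y `` {{#(a \<rightharpoonup>\<^bsub>X\<^esub> x, y). (x, y) \<in># u#}}),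
     ract = (\<lambda>P c. \<Union>u \<in> P. tensor_cong X B Y `` {{#(x, y \<leftharpoonup>\<^bsub>Y\<^esub> c). (x, y) \<in># u#}})\<rparr>"

lemma formal_sums_plus: "u \<in> formal_sums X Y \<Longrightarrow> v \<in> formal_sums X Y \<Longrightarrow> u + v \<in> formal_sums X Y"
  by (auto simp: formal_sums_def)

lemma tensor_cong_formal_sums:
  assumes "semibimodule A B X" and "semibimodule B C Y" and "(u, v) \<in> tensor_cong X B Y"
  shows "u \<in> formal_sums X Y \<and> v \<in> formal_sums X Y"
proof -
  interpret X: semibimodule A B X by fact
  interpret Y: semibimodule B C Y by fact
  from assms(3) show ?thesis
    by induction (auto simp: formal_sums_def X.ract_closed Y.lact_closed)
qed

lemma equiv_tensor_cong:
  assumes "semibimodule A B X" and "semibimodule B C Y"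
  shows "equiv (formal_sums X Y) (tensor_cong X B Y)"
proof (rule equivI)
  show "tensor_cong X B Y \<subseteq> formal_sums X Y \<times> formal_sums X Y"
    using tensor_cong_formal_sums[OF assms] by auto
  show "refl_on (formal_sums X Y) (tensor_cong X B Y)"
    using tensor_cong_formal_sums[OF assms] by (auto intro!: refl_onI tensor_cong.refl)
  show "Relation.sym (tensor_cong X B Y)"
    by (auto intro: symI tensor_cong.sym)
  show "Relation.trans (tensor_cong X B Y)"
    by (auto intro: transI tensor_cong.trans)
qed

lemma semibimodule_tensor:
  fixes X :: "('a, 'b, 'x, 'm) bimodule_scheme" and Y :: "('b, 'c, 'y, 'n) bimodule_scheme"
  assumes "semibimodule A B X" and "semibimodule B C Y"
  shows "semibimodule A C (tensor X B Y)"
proof -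
  interpret X: semibimodule A B X by fact
  interpret Y: semibimodule B C Y by fact
  let ?F = "formal_sums X Y" and ?r = "tensor_cong X B Y" and ?T = "tensor X B Y"
  define cls where "cls u = ?r `` {u}" for u
  define la :: "'a \<Rightarrow> ('x \<times> 'y) multiset \<Rightarrow> ('x \<times> 'y) multiset" where
    "la a = image_mset (\<lambda>(x, y). (a \<rightharpoonup>\<^bsub>X\<^esub> x, y))" for a
  define ra :: "'c \<Rightarrow> ('x \<times> 'y) multiset \<Rightarrow> ('x \<times> 'y) multiset" where
    "ra c = image_mset (\<lambda>(x, y). (x, y \<leftharpoonup>\<^bsub>Y\<^esub> c))" for c
  note eqv = equiv_tensor_cong[OF assms]
  have cls_eq: "cls u = cls v" if "(u, v) \<in> ?r" for u v
    using equiv_class_eq[OF eqv that] by (simp add: cls_def)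
  have mem: "v \<in> cls u \<longleftrightarrow> (u, v) \<in> ?r" for u v by (simp add: cls_def)
  have carr: "carrier ?T = cls ` ?F"
    by (auto simp: tensor_def quotient_def cls_def)
  have laF: "la a u \<in> ?F" if "a \<in> carrier A" "u \<in> ?F" for a u
    using that by (auto simp: la_def formal_sums_def X.lact_closed)
  have raF: "ra c u \<in> ?F" if "c \<in> carrier C" "u \<in> ?F" for c u
    using that by (auto simp: ra_def formal_sums_def Y.ract_closed)
  have la_r: "(la a u, la a v) \<in> ?r" if "(u, v) \<in> ?r" and a: "a \<in> carrier A" for a u v
    using that(1)
  proof induction
    case (refl u) then show ?case using laF[OF a] by (auto intro: tensor_cong.refl)
  next
    case (sym u v) then show ?case by (blast intro: tensor_cong.sym)
  next
    case (trans u v w) then show ?case by (blast intro: tensor_cong.trans)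
  next
    case (plus u v u' v') then show ?case by (auto simp: la_def intro: tensor_cong.plus)
  next
    case (add_left x x' y) then show ?case
      using a by (auto simp: la_def X.lact_add_right X.lact_closed intro: tensor_cong.add_left)
  next
    case (add_right x y y') then show ?case
      using a by (auto simp: la_def X.lact_closed intro: tensor_cong.add_right)
  next
    case (zero_left y)
    have "a \<rightharpoonup>\<^bsub>X\<^esub> \<zero>\<^bsub>X\<^esub> = \<zero>\<^bsub>X\<^esub>"
      using a X.lact_mult[of a "\<zero>\<^bsub>A\<^esub>" "\<zero>\<^bsub>X\<^esub>"] X.lact_zero[of "\<zero>\<^bsub>X\<^esub>"] by simp
    with zero_left show ?case by (auto simp: la_def intro: tensor_cong.zero_left)
  next
    case (zero_right x) then show ?case
      using a by (auto simp: la_def X.lact_closed intro: tensor_cong.zero_right)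
  next
    case (balanced x b y) then show ?case
      using a by (auto simp: la_def X.lact_closed X.act_assoc intro: tensor_cong.balanced)
  qed
  have ra_r: "(ra c u, ra c v) \<in> ?r" if "(u, v) \<in> ?r" and c: "c \<in> carrier C" for c u v
    using that(1)
  proof induction
    case (refl u) then show ?case using raF[OF c] by (auto intro: tensor_cong.refl)
  next
    case (sym u v) then show ?case by (blast intro: tensor_cong.sym)
  next
    case (trans u v w) then show ?case by (blast intro: tensor_cong.trans)
  next
    case (plus u v u' v') then show ?case by (auto simp: ra_def intro: tensor_cong.plus)
  next
    case (add_left x x' y) then show ?case
      using c by (auto simp: ra_def Y.ract_closed intro: tensor_cong.add_left)
  next
    case (add_right x y y') then show ?case
      using c by (auto simp: ra_def Y.ract_add_left Y.ract_closed intro: tensor_cong.add_right)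
  next
    case (zero_left y) then show ?case
      using c by (auto simp: ra_def Y.ract_closed intro: tensor_cong.zero_left)
  next
    case (zero_right x)
    have "\<zero>\<^bsub>Y\<^esub> \<leftharpoonup>\<^bsub>Y\<^esub> c = \<zero>\<^bsub>Y\<^esub>"
      using c Y.ract_mult[of "\<zero>\<^bsub>C\<^esub>" c "\<zero>\<^bsub>Y\<^esub>"] Y.ract_zero[of "\<zero>\<^bsub>Y\<^esub>"] by simp
    with zero_right show ?case by (auto simp: ra_def intro: tensor_cong.zero_right)
  next
    case (balanced x b y) then show ?case
      using c by (auto simp: ra_def Y.ract_closed Y.act_assoc[symmetric] intro: tensor_cong.balanced)
  qed
  have UN_const: "(\<Union>p \<in> P. g p) = w" if "q \<in> P" "\<And>p. p \<in> P \<Longrightarrow> g p = w"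
    for q :: "('x \<times> 'y) multiset" and P g and w :: "('x \<times> 'y) multiset set"
    using that by auto
  have add: "cls u \<oplus>\<^bsub>?T\<^esub> cls v = cls (u + v)" if "u \<in> ?F" "v \<in> ?F" for u v
  proof -
    have *: "cls (u' + v') = cls (u + v)" if "u' \<in> cls u" "v' \<in> cls v" for u' v'
      using that by (intro cls_eq[symmetric] tensor_cong.plus) (auto simp: mem)
    have refl: "u \<in> cls u" "v \<in> cls v" using that by (auto simp: mem intro: tensor_cong.refl)
    have eq: "cls u \<oplus>\<^bsub>?T\<^esub> cls v = (\<Union>u' \<in> cls u. \<Union>v' \<in> cls v. cls (u' + v'))"
      by (simp add: tensor_def cls_def)
    show ?thesis unfolding eq by (intro UN_const[OF refl(1)] UN_const[OF refl(2)] *)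
  qed
  have lact: "a \<rightharpoonup>\<^bsub>?T\<^esub> cls u = cls (la a u)" if "a \<in> carrier A" "u \<in> ?F" for a u
  proof -
    have *: "cls (la a u') = cls (la a u)" if "u' \<in> cls u" for u'
      using that \<open>a \<in> carrier A\<close> by (intro cls_eq[symmetric] la_r) (auto simp: mem)
    have refl: "u \<in> cls u" using that by (auto simp: mem intro: tensor_cong.refl)
    have eq: "a \<rightharpoonup>\<^bsub>?T\<^esub> cls u = (\<Union>u' \<in> cls u. cls (la a u'))"
      by (simp add: tensor_def cls_def la_def)
    show ?thesis unfolding eq by (intro UN_const[OF refl] *)
  qed
  have ract: "cls u \<leftharpoonup>\<^bsub>?T\<^esub> c = cls (ra c u)" if "c \<in> carrier C" "u \<in> ?F" for c u
  proof -
    have *: "cls (ra c u') = cls (ra c u)" if "u' \<in> cls u" for u'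
      using that \<open>c \<in> carrier C\<close> by (intro cls_eq[symmetric] ra_r) (auto simp: mem)
    have refl: "u \<in> cls u" using that by (auto simp: mem intro: tensor_cong.refl)
    have eq: "cls u \<leftharpoonup>\<^bsub>?T\<^esub> c = (\<Union>u' \<in> cls u. cls (ra c u'))"
      by (simp add: tensor_def cls_def ra_def)
    show ?thesis unfolding eq by (intro UN_const[OF refl] *)
  qed
  have zero: "\<zero>\<^bsub>?T\<^esub> = cls {#}" by (simp add: tensor_def cls_def)
  have F0: "{#} \<in> ?F" by (simp add: formal_sums_def)
  have Fins: "add_mset (x, y) u \<in> ?F \<longleftrightarrow> x \<in> carrier X \<and> y \<in> carrier Y \<and> u \<in> ?F" for x y u
    by (auto simp: formal_sums_def)
  have la_plus: "la a (u + v) = la a u + la a v" for a u v by (simp add: la_def)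
  have ra_plus: "ra c (u + v) = ra c u + ra c v" for c u v by (simp add: ra_def)
  have la_add: "(la (a \<oplus>\<^bsub>A\<^esub> a') u, la a u + la a' u) \<in> ?r"
    if "a \<in> carrier A" "a' \<in> carrier A" "u \<in> ?F" for a a' u
    using that(3)
  proof (induction u)
    case empty then show ?case using F0 by (simp add: la_def tensor_cong.refl)
  next
    case (add p u)
    obtain x y where p: "p = (x, y)" by (cases p)
    with add have *: "x \<in> carrier X" "y \<in> carrier Y" "(la (a \<oplus>\<^bsub>A\<^esub> a') u, la a u + la a' u) \<in> ?r"
      by (simp_all add: Fins)
    have "({#(a \<rightharpoonup>\<^bsub>X\<^esub> x \<oplus>\<^bsub>X\<^esub> a' \<rightharpoonup>\<^bsub>X\<^esub> x, y)#}, {#(a \<rightharpoonup>\<^bsub>X\<^esub> x, y), (a' \<rightharpoonup>\<^bsub>X\<^esub> x, y)#}) \<in> ?r"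
      using * that by (intro tensor_cong.add_left) (auto simp: X.lact_closed)
    from tensor_cong.plus[OF this *(3)] show ?case
      using * that by (simp add: p la_def X.lact_add_left ac_simps)
  qed
  have ra_add: "(ra (c \<oplus>\<^bsub>C\<^esub> c') u, ra c u + ra c' u) \<in> ?r"
    if "c \<in> carrier C" "c' \<in> carrier C" "u \<in> ?F" for c c' u
    using that(3)
  proof (induction u)
    case empty then show ?case using F0 by (simp add: ra_def tensor_cong.refl)
  next
    case (add p u)
    obtain x y where p: "p = (x, y)" by (cases p)
    with add have *: "x \<in> carrier X" "y \<in> carrier Y" "(ra (c \<oplus>\<^bsub>C\<^esub> c') u, ra c u + ra c' u) \<in> ?r"
      by (simp_all add: Fins)
    have "({#(x, y \<leftharpoonup>\<^bsub>Y\<^esub> c \<oplus>\<^bsub>Y\<^esub> y \<leftharpoonup>\<^bsub>Y\<^esub> c')#}, {#(x, y \<leftharpoonup>\<^bsub>Y\<^esub> c), (x, y \<leftharpoonup>\<^bsub>Y\<^esub> c')#}) \<in> ?r"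
      using * that by (intro tensor_cong.add_right) (auto simp: Y.ract_closed)
    from tensor_cong.plus[OF this *(3)] show ?case
      using * that by (simp add: p ra_def Y.ract_add_right ac_simps)
  qed
  have la_zero: "(la \<zero>\<^bsub>A\<^esub> u, {#}) \<in> ?r" if "u \<in> ?F" for u
    using that
  proof (induction u)
    case empty then show ?case using F0 by (simp add: la_def tensor_cong.refl)
  next
    case (add p u)
    obtain x y where p: "p = (x, y)" by (cases p)
    with add have *: "x \<in> carrier X" "y \<in> carrier Y" "(la \<zero>\<^bsub>A\<^esub> u, {#}) \<in> ?r" by (simp_all add: Fins)
    from tensor_cong.plus[OF tensor_cong.zero_left[OF *(2)] *(3)] show ?case
      using * by (simp add: p la_def X.lact_zero)
  qed
  have ra_zero: "(ra \<zero>\<^bsub>C\<^esub> u, {#}) \<in> ?r" if "u \<in> ?F" for u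
    using that
  proof (induction u)
    case empty then show ?case using F0 by (simp add: ra_def tensor_cong.refl)
  next
    case (add p u)
    obtain x y where p: "p = (x, y)" by (cases p)
    with add have *: "x \<in> carrier X" "y \<in> carrier Y" "(ra \<zero>\<^bsub>C\<^esub> u, {#}) \<in> ?r" by (simp_all add: Fins)
    from tensor_cong.plus[OF tensor_cong.zero_right[OF *(1)] *(3)] show ?case
      using * by (simp add: p ra_def Y.ract_zero)
  qed
  have la_mult: "la a (la a' u) = la (a \<otimes>\<^bsub>A\<^esub> a') u"
    if "a \<in> carrier A" "a' \<in> carrier A" "u \<in> ?F" for a a' u
    using that unfolding la_def multiset.map_comp
    by (intro multiset.map_cong0) (auto simp: formal_sums_def X.lact_mult)
  have ra_mult: "ra c' (ra c u) = ra (c \<otimes>\<^bsub>C\<^esub> c') u"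
    if "c \<in> carrier C" "c' \<in> carrier C" "u \<in> ?F" for c c' u
    using that unfolding ra_def multiset.map_comp
    by (intro multiset.map_cong0) (auto simp: formal_sums_def Y.ract_mult)
  have la_one: "la \<one>\<^bsub>A\<^esub> u = u" if "u \<in> ?F" for u
    using that unfolding la_def
    by (intro multiset.map_ident_strong) (auto simp: formal_sums_def X.lact_one)
  have ra_one: "ra \<one>\<^bsub>C\<^esub> u = u" if "u \<in> ?F" for u
    using that unfolding ra_def
    by (intro multiset.map_ident_strong) (auto simp: formal_sums_def Y.ract_one)
  have la_ra: "la a (ra c u) = ra c (la a u)" for a c u
    unfolding la_def ra_def multiset.map_comp by (intro multiset.map_cong0) auto
  have "abelian_monoid ?T"
    by (rule abelian_monoidI) (auto simp: carr add zero F0 formal_sums_plus ac_simps)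
  then interpret T: abelian_monoid ?T .
  show ?thesis
    by unfold_locales
      (auto simp: carr add zero lact ract laF raF formal_sums_plus la_plus ra_plus la_mult ra_mult
        la_one ra_one la_ra la_add[THEN cls_eq] ra_add[THEN cls_eq] la_zero[THEN cls_eq]
        ra_zero[THEN cls_eq])
qed

section \<open>Morita equivalence\<close>

text \<open>
  The bimodules are parameters because HOL has no quantification over their element types.
  Two Kleene algebras are Morita-equivalent iff this holds for some \<open>X\<close> and \<open>Y\<close> (of some types).
\<close>

definition kleene_morita_equivalence_by ::
  "('k, 'm) kleene_scheme \<Rightarrow> ('s, 'n) kleene_scheme \<Rightarrow>
   ('k, 's, 'x, 'p) bimodule_scheme \<Rightarrow> ('s, 'k, 'y, 'q) bimodule_scheme \<Rightarrow> bool" where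
  "kleene_morita_equivalence_by K S X Y \<longleftrightarrow>
    kleene_bimodule K S X \<and> kleene_bimodule S K Y \<and>
    bimodule_iso K K (tensor X S Y) (regular_bimodule K) \<noteq> {} \<and>
    bimodule_iso S S (tensor Y K X) (regular_bimodule S) \<noteq> {}"

section \<open>Matrix semirings, full idempotents and corners\<close>

text \<open>
  The type \<^typ>\<open>'a mat\<close> serves as a container for the entries only: its class-based arithmetic
  does not apply to semirings given by a carrier.
\<close>

definition mat_semiring :: "('a, 'm) ring_scheme \<Rightarrow> nat \<Rightarrow> 'a mat ring" where
  "mat_semiring R n =
    \<lparr>carrier = {A \<in> carrier_mat n n. \<forall>i<n. \<forall>j<n. A $$ (i, j) \<in> carrier R},
     monoid.mult = (\<lambda>A B. mat n n (\<lambda>(i, j). \<Oplus>\<^bsub>R\<^esub>k\<in>{..<n}. A $$ (i, k) \<otimes>\<^bsub>R\<^esub> B $$ (k, j))),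
     one = mat n n (\<lambda>(i, j). if i = j then \<one>\<^bsub>R\<^esub> else \<zero>\<^bsub>R\<^esub>),
     zero = mat n n (\<lambda>(i, j). \<zero>\<^bsub>R\<^esub>),
     add = (\<lambda>A B. mat n n (\<lambda>(i, j). A $$ (i, j) \<oplus>\<^bsub>R\<^esub> B $$ (i, j)))\<rparr>"

definition mult_idempotent :: "('a, 'm) ring_scheme \<Rightarrow> 'a \<Rightarrow> bool" where
  "mult_idempotent R e \<longleftrightarrow> e \<in> carrier R \<and> e \<otimes>\<^bsub>R\<^esub> e = e"

definition two_sided_span :: "('a, 'm) ring_scheme \<Rightarrow> 'a \<Rightarrow> 'a set" where
  "two_sided_span R e =
    {\<Oplus>\<^bsub>R\<^esub>i\<in>{..<m}. r i \<otimes>\<^bsub>R\<^esub> e \<otimes>\<^bsub>R\<^esub> s i | (m::nat) r s.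
      r \<in> {..<m} \<rightarrow> carrier R \<and> s \<in> {..<m} \<rightarrow> carrier R}"

definition full_element :: "('a, 'm) ring_scheme \<Rightarrow> 'a \<Rightarrow> bool" where
  "full_element R e \<longleftrightarrow> e \<in> carrier R \<and> two_sided_span R e = carrier R"

text \<open>
  Corners are compared with \<^const>\<open>is_ring_iso\<close>: a bijection preserving addition,
  multiplication and one. Between semirings it preserves zero as well, by surjectivity.
\<close>

definition corner :: "('a, 'm) ring_scheme \<Rightarrow> 'a \<Rightarrow> ('a, 'm) ring_scheme" where
  "corner R e = R\<lparr>carrier := {e \<otimes>\<^bsub>R\<^esub> r \<otimes>\<^bsub>R\<^esub> e | r. r \<in> carrier R}, one := e\<rparr>"

lemma semiring_mat_semiring:
  fixes R (structure)
  assumes "semiring R"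
  shows "semiring (mat_semiring R n)"
proof -
  interpret semiring R by fact
  have sum_closed: "(\<Oplus>k\<in>{..<n}. f k) \<in> carrier R" if "\<And>k. k < n \<Longrightarrow> f k \<in> carrier R" for f
    using that by (intro finsum_closed) auto
  have ldist: "(\<Oplus>k\<in>{..<n}. f k) \<otimes> c = (\<Oplus>k\<in>{..<n}. f k \<otimes> c)"
    if "\<And>k. k < n \<Longrightarrow> f k \<in> carrier R" "c \<in> carrier R" for f c
    using that by (intro finsum_ldistr) auto
  have rdist: "c \<otimes> (\<Oplus>k\<in>{..<n}. f k) = (\<Oplus>k\<in>{..<n}. c \<otimes> f k)"
    if "\<And>k. k < n \<Longrightarrow> f k \<in> carrier R" "c \<in> carrier R" for f c
    using that by (intro finsum_rdistr) auto
  have add: "(\<Oplus>k\<in>{..<n}. f k \<oplus> g k) = (\<Oplus>k\<in>{..<n}. f k) \<oplus> (\<Oplus>k\<in>{..<n}. g k)"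
    if "\<And>k. k < n \<Longrightarrow> f k \<in> carrier R" "\<And>k. k < n \<Longrightarrow> g k \<in> carrier R" for f g
    using that by (intro finsum_addf) auto
  have cong: "(\<Oplus>k\<in>{..<n}. f k) = (\<Oplus>k\<in>{..<n}. g k)"
    if "\<And>k. k < n \<Longrightarrow> f k = g k" "\<And>k. k < n \<Longrightarrow> g k \<in> carrier R" for f g
    using that by (intro finsum_cong') auto
  have swap: "(\<Oplus>k\<in>{..<n}. \<Oplus>l\<in>{..<m}. f k l) = (\<Oplus>l\<in>{..<m}. \<Oplus>k\<in>{..<n}. f k l)"
    if "\<And>k l. k < n \<Longrightarrow> l < m \<Longrightarrow> f k l \<in> carrier R" for f and m :: nat
    using that
  proof (induction m)
    case 0 then show ?case by (simp add: finsum_zero)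
  next
    case (Suc m)
    have "(\<Oplus>k\<in>{..<n}. \<Oplus>l\<in>{..<Suc m}. f k l) = (\<Oplus>k\<in>{..<n}. f k m \<oplus> (\<Oplus>l\<in>{..<m}. f k l))"
      using Suc.prems by (intro cong) (auto simp: lessThan_Suc intro!: finsum_closed)
    also have "\<dots> = (\<Oplus>k\<in>{..<n}. f k m) \<oplus> (\<Oplus>k\<in>{..<n}. \<Oplus>l\<in>{..<m}. f k l)"
      using Suc.prems by (intro add) (auto intro!: finsum_closed)
    also have "\<dots> = (\<Oplus>l\<in>{..<Suc m}. \<Oplus>k\<in>{..<n}. f k l)"
      using Suc by (auto simp: lessThan_Suc intro!: finsum_closed)
    finally show ?case .
  qed
  have single: "(\<Oplus>k\<in>{..<n}. if k = i then f k else \<zero>) = f i"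
    if "i < n" "\<And>k. k < n \<Longrightarrow> f k \<in> carrier R" for i f
    using that add.finprod_singleton_swap[of i "{..<n}" f] by (auto simp: finsum_def)
  have assoc: "(\<Oplus>k\<in>{..<n}. (\<Oplus>l\<in>{..<n}. x l \<otimes> y l k) \<otimes> z k) =
      (\<Oplus>l\<in>{..<n}. x l \<otimes> (\<Oplus>k\<in>{..<n}. y l k \<otimes> z k))"
    if x: "\<And>k. k < n \<Longrightarrow> x k \<in> carrier R" and z: "\<And>k. k < n \<Longrightarrow> z k \<in> carrier R"
      and y: "\<And>k l. k < n \<Longrightarrow> l < n \<Longrightarrow> y k l \<in> carrier R" for x y z
  proof -
    have "(\<Oplus>k\<in>{..<n}. (\<Oplus>l\<in>{..<n}. x l \<otimes> y l k) \<otimes> z k) =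
        (\<Oplus>k\<in>{..<n}. \<Oplus>l\<in>{..<n}. x l \<otimes> (y l k \<otimes> z k))"
      using x y z by (intro cong) (auto simp: ldist m_assoc intro!: cong sum_closed)
    also have "\<dots> = (\<Oplus>l\<in>{..<n}. \<Oplus>k\<in>{..<n}. x l \<otimes> (y l k \<otimes> z k))"
      using x y z by (intro swap) auto
    also have "\<dots> = (\<Oplus>l\<in>{..<n}. x l \<otimes> (\<Oplus>k\<in>{..<n}. y l k \<otimes> z k))"
      using x y z by (intro cong) (auto simp: rdist intro!: sum_closed)
    finally show ?thesis .
  qed
  have lone: "(\<Oplus>k\<in>{..<n}. (if i = k then \<one> else \<zero>) \<otimes> f k) = f i"
    if "i < n" "\<And>k. k < n \<Longrightarrow> f k \<in> carrier R" for i f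
    using that by (subst single[of i f, symmetric]) (auto intro!: cong)
  have rone: "(\<Oplus>k\<in>{..<n}. f k \<otimes> (if k = j then \<one> else \<zero>)) = f j"
    if "j < n" "\<And>k. k < n \<Longrightarrow> f k \<in> carrier R" for j f
    using that by (subst single[of j f, symmetric]) (auto intro!: cong)
  have z: "(\<Oplus>k\<in>{..<n}. f k) = \<zero>" if "\<And>k. k < n \<Longrightarrow> f k = \<zero>" for f
    using cong[of f "\<lambda>_. \<zero>"] that by simp
  let ?M = "mat_semiring R n"
  have carr: "A \<in> carrier ?M \<longleftrightarrow> A \<in> carrier_mat n n \<and> (\<forall>i<n. \<forall>j<n. A $$ (i, j) \<in> carrier R)" for A
    by (simp add: mat_semiring_def)
  have ent: "A $$ (i, j) \<in> carrier R" if "A \<in> carrier ?M" "i < n" "j < n" for A i j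
    using that by (simp add: carr)
  have dim: "dim_row A = n" "dim_col A = n" if "A \<in> carrier ?M" for A
    using that by (auto simp: carr)
  have eqI: "A = B" if "A \<in> carrier ?M" "B \<in> carrier ?M"
    "\<And>i j. i < n \<Longrightarrow> j < n \<Longrightarrow> A $$ (i, j) = B $$ (i, j)" for A B
    using that by (intro eq_matI) (auto simp: dim)
  have add_ix: "(A \<oplus>\<^bsub>?M\<^esub> B) $$ (i, j) = A $$ (i, j) \<oplus> B $$ (i, j)" if "i < n" "j < n" for A B i j
    using that by (simp add: mat_semiring_def)
  have mult_ix: "(A \<otimes>\<^bsub>?M\<^esub> B) $$ (i, j) = (\<Oplus>k\<in>{..<n}. A $$ (i, k) \<otimes> B $$ (k, j))"
    if "i < n" "j < n" for A B i j
    using that by (simp add: mat_semiring_def)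
  have zero_ix: "\<zero>\<^bsub>?M\<^esub> $$ (i, j) = \<zero>" if "i < n" "j < n" for i j
    using that by (simp add: mat_semiring_def)
  have one_ix: "\<one>\<^bsub>?M\<^esub> $$ (i, j) = (if i = j then \<one> else \<zero>)" if "i < n" "j < n" for i j
    using that by (simp add: mat_semiring_def)
  have add_c: "A \<oplus>\<^bsub>?M\<^esub> B \<in> carrier ?M" if "A \<in> carrier ?M" "B \<in> carrier ?M" for A B
    using that by (simp add: mat_semiring_def)
  have mult_c: "A \<otimes>\<^bsub>?M\<^esub> B \<in> carrier ?M" if "A \<in> carrier ?M" "B \<in> carrier ?M" for A B
    using that by (simp add: mat_semiring_def sum_closed)
  have zero_c: "\<zero>\<^bsub>?M\<^esub> \<in> carrier ?M" and one_c: "\<one>\<^bsub>?M\<^esub> \<in> carrier ?M"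
    by (simp_all add: mat_semiring_def)
  note closed = add_c mult_c zero_c one_c
  note ix = add_ix mult_ix zero_ix one_ix
  show ?thesis
  proof (intro semiring.intro semiring_axioms.intro abelian_monoidI monoidI)
    fix x y z assume xyz: "x \<in> carrier ?M" "y \<in> carrier ?M" "z \<in> carrier ?M"
    show "x \<oplus>\<^bsub>?M\<^esub> y \<oplus>\<^bsub>?M\<^esub> z = x \<oplus>\<^bsub>?M\<^esub> (y \<oplus>\<^bsub>?M\<^esub> z)"
      using xyz by (intro eqI closed) (simp_all add: ix ent a_assoc)
    show "x \<otimes>\<^bsub>?M\<^esub> y \<otimes>\<^bsub>?M\<^esub> z = x \<otimes>\<^bsub>?M\<^esub> (y \<otimes>\<^bsub>?M\<^esub> z)"
    proof (intro eqI closed xyz)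
      fix i j assume ij: "i < n" "j < n"
      have "(x \<otimes>\<^bsub>?M\<^esub> y \<otimes>\<^bsub>?M\<^esub> z) $$ (i, j) =
          (\<Oplus>k\<in>{..<n}. (\<Oplus>l\<in>{..<n}. x $$ (i, l) \<otimes> y $$ (l, k)) \<otimes> z $$ (k, j))"
        unfolding mult_ix[OF ij]
        using xyz ij by (intro cong) (simp_all add: mult_ix ent sum_closed)
      also have "\<dots> = (\<Oplus>l\<in>{..<n}. x $$ (i, l) \<otimes> (\<Oplus>k\<in>{..<n}. y $$ (l, k) \<otimes> z $$ (k, j)))"
        using xyz ij by (intro assoc) (simp_all add: ent)
      also have "\<dots> = (x \<otimes>\<^bsub>?M\<^esub> (y \<otimes>\<^bsub>?M\<^esub> z)) $$ (i, j)"
        unfolding mult_ix[OF ij]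
        using xyz ij by (intro cong) (simp_all add: mult_ix ent sum_closed)
      finally show "(x \<otimes>\<^bsub>?M\<^esub> y \<otimes>\<^bsub>?M\<^esub> z) $$ (i, j) = (x \<otimes>\<^bsub>?M\<^esub> (y \<otimes>\<^bsub>?M\<^esub> z)) $$ (i, j)" .
    qed
    show "(x \<oplus>\<^bsub>?M\<^esub> y) \<otimes>\<^bsub>?M\<^esub> z = x \<otimes>\<^bsub>?M\<^esub> z \<oplus>\<^bsub>?M\<^esub> y \<otimes>\<^bsub>?M\<^esub> z"
    proof (intro eqI closed xyz)
      fix i j assume ij: "i < n" "j < n"
      have "((x \<oplus>\<^bsub>?M\<^esub> y) \<otimes>\<^bsub>?M\<^esub> z) $$ (i, j) = (\<Oplus>k\<in>{..<n}. x $$ (i, k) \<otimes> z $$ (k, j) \<oplus> y $$ (i, k) \<otimes> z $$ (k, j))"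
        unfolding mult_ix[OF ij] using xyz ij by (intro cong) (simp_all add: add_ix ent l_distr)
      also have "\<dots> = (x \<otimes>\<^bsub>?M\<^esub> z \<oplus>\<^bsub>?M\<^esub> y \<otimes>\<^bsub>?M\<^esub> z) $$ (i, j)"
        unfolding add_ix[OF ij] mult_ix[OF ij] using xyz ij by (intro add) (simp_all add: ent)
      finally show "((x \<oplus>\<^bsub>?M\<^esub> y) \<otimes>\<^bsub>?M\<^esub> z) $$ (i, j) = (x \<otimes>\<^bsub>?M\<^esub> z \<oplus>\<^bsub>?M\<^esub> y \<otimes>\<^bsub>?M\<^esub> z) $$ (i, j)" .
    qed
    show "z \<otimes>\<^bsub>?M\<^esub> (x \<oplus>\<^bsub>?M\<^esub> y) = z \<otimes>\<^bsub>?M\<^esub> x \<oplus>\<^bsub>?M\<^esub> z \<otimes>\<^bsub>?M\<^esub> y"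
    proof (intro eqI closed xyz)
      fix i j assume ij: "i < n" "j < n"
      have "(z \<otimes>\<^bsub>?M\<^esub> (x \<oplus>\<^bsub>?M\<^esub> y)) $$ (i, j) = (\<Oplus>k\<in>{..<n}. z $$ (i, k) \<otimes> x $$ (k, j) \<oplus> z $$ (i, k) \<otimes> y $$ (k, j))"
        unfolding mult_ix[OF ij] using xyz ij by (intro cong) (simp_all add: add_ix ent r_distr)
      also have "\<dots> = (z \<otimes>\<^bsub>?M\<^esub> x \<oplus>\<^bsub>?M\<^esub> z \<otimes>\<^bsub>?M\<^esub> y) $$ (i, j)"
        unfolding add_ix[OF ij] mult_ix[OF ij] using xyz ij by (intro add) (simp_all add: ent)
      finally show "(z \<otimes>\<^bsub>?M\<^esub> (x \<oplus>\<^bsub>?M\<^esub> y)) $$ (i, j) = (z \<otimes>\<^bsub>?M\<^esub> x \<oplus>\<^bsub>?M\<^esub> z \<otimes>\<^bsub>?M\<^esub> y) $$ (i, j)" .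
    qed
  next
    fix x y assume xy: "x \<in> carrier ?M" "y \<in> carrier ?M"
    show "x \<oplus>\<^bsub>?M\<^esub> y = y \<oplus>\<^bsub>?M\<^esub> x"
      using xy by (intro eqI closed) (simp_all add: ix ent a_comm)
  next
    fix x assume x: "x \<in> carrier ?M"
    show "\<zero>\<^bsub>?M\<^esub> \<oplus>\<^bsub>?M\<^esub> x = x"
      using x by (intro eqI closed) (simp_all add: ix ent)
    show "\<zero>\<^bsub>?M\<^esub> \<otimes>\<^bsub>?M\<^esub> x = \<zero>\<^bsub>?M\<^esub>" "x \<otimes>\<^bsub>?M\<^esub> \<zero>\<^bsub>?M\<^esub> = \<zero>\<^bsub>?M\<^esub>"
      using x by (intro eqI closed; simp add: ix ent z)+
    show "\<one>\<^bsub>?M\<^esub> \<otimes>\<^bsub>?M\<^esub> x = x"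
    proof (intro eqI closed x)
      fix i j assume ij: "i < n" "j < n"
      have "(\<one>\<^bsub>?M\<^esub> \<otimes>\<^bsub>?M\<^esub> x) $$ (i, j) = (\<Oplus>k\<in>{..<n}. (if i = k then \<one> else \<zero>) \<otimes> x $$ (k, j))"
        unfolding mult_ix[OF ij] using x ij by (intro cong) (simp_all add: one_ix ent)
      then show "(\<one>\<^bsub>?M\<^esub> \<otimes>\<^bsub>?M\<^esub> x) $$ (i, j) = x $$ (i, j)"
        using lone[of i "\<lambda>k. x $$ (k, j)"] x ij by (simp add: ent)
    qed
    show "x \<otimes>\<^bsub>?M\<^esub> \<one>\<^bsub>?M\<^esub> = x"
    proof (intro eqI closed x)
      fix i j assume ij: "i < n" "j < n"
      have "(x \<otimes>\<^bsub>?M\<^esub> \<one>\<^bsub>?M\<^esub>) $$ (i, j) = (\<Oplus>k\<in>{..<n}. x $$ (i, k) \<otimes> (if k = j then \<one> else \<zero>))"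
        unfolding mult_ix[OF ij] using x ij by (intro cong) (simp_all add: one_ix ent)
      then show "(x \<otimes>\<^bsub>?M\<^esub> \<one>\<^bsub>?M\<^esub>) $$ (i, j) = x $$ (i, j)"
        using rone[of j "\<lambda>k. x $$ (i, k)"] x ij by (simp add: ent)
    qed
  qed (use closed in auto)
qed

lemma semiring_corner:
  fixes R (structure)
  assumes "semiring R" and "mult_idempotent R e"
  shows "semiring (corner R e)"
proof -
  interpret semiring R by fact
  have e: "e \<in> carrier R" "e \<otimes> e = e" using assms(2) by (auto simp: mult_idempotent_def)
  have el: "e \<otimes> (e \<otimes> r) = e \<otimes> r" if "r \<in> carrier R" for r
    using e that by (simp add: m_assoc[symmetric])
  have carr: "carrier (corner R e) = {x \<in> carrier R. e \<otimes> x = x \<and> x \<otimes> e = x}"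
    using e el by (auto simp: corner_def m_assoc) metis
  have ops: "add (corner R e) = add R" "monoid.mult (corner R e) = monoid.mult R"
    "\<zero>\<^bsub>corner R e\<^esub> = \<zero>" "\<one>\<^bsub>corner R e\<^esub> = e"
    by (simp_all add: corner_def)
  show ?thesis
    by (intro semiring.intro semiring_axioms.intro abelian_monoidI monoidI;
        unfold carr ops; use e in \<open>auto simp: l_distr r_distr a_ac m_assoc\<close>)
      (simp_all add: m_assoc[symmetric])
qed

end

theory Submission
  imports Defs
begin

text \<open>
  The isomorphisms \<open>X \<otimes> Y \<cong> K\<close> and \<open>Y \<otimes> X \<cong> S\<close> give pairings \<open>f : X \<times> Y \<rightarrow> K\<close> and \<open>g : Y \<times> X \<rightarrow> S\<close>, which
  can be made compatible: \<open>f x y \<rightharpoonup> x' = x \<leftharpoonup> g y x'\<close>. Writing \<open>1 = g y\<^sub>1 x\<^sub>1 + \<dots> + g y\<^sub>n x\<^sub>n\<close> in \<open>S\<close>, the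
  \<open>x\<^sub>j\<close> generate \<open>X\<close> over \<open>K\<close> with coordinates \<open>f z y\<^sub>j\<close>. Hence \<open>s \<mapsto> (f (x\<^sub>i s) y\<^sub>j)\<^sub>i\<^sub>j\<close> is
  multiplicative and identifies \<open>S\<close> with the corner at \<open>e = (f x\<^sub>i y\<^sub>j)\<^sub>i\<^sub>j\<close>; this \<open>e\<close> is full because
  \<open>1\<close> is a sum of values of \<open>f\<close>.
\<close>

section \<open>Finite sums\<close>

text \<open>Preservation of zero is a separate hypothesis: the monoids need not be cancellative, so
  it does not follow from additivity.\<close>

lemma finsum_additive:
  assumes "abelian_monoid M" and "abelian_monoid N"
    and h: "\<And>x. x \<in> carrier M \<Longrightarrow> h x \<in> carrier N"
    and h_add: "\<And>x y. x \<in> carrier M \<Longrightarrow> y \<in> carrier M \<Longrightarrow> h (x \<oplus>\<^bsub>M\<^esub> y) = h x \<oplus>\<^bsub>N\<^esub> h y"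
    and h_zero: "h \<zero>\<^bsub>M\<^esub> = \<zero>\<^bsub>N\<^esub>"
    and "finite I" and "\<And>i. i \<in> I \<Longrightarrow> F i \<in> carrier M"
  shows "h (finsum M F I) = finsum N (\<lambda>i. h (F i)) I"
proof -
  interpret M: abelian_monoid M by fact
  interpret N: abelian_monoid N by fact
  show ?thesis
    using assms(6,7)
  proof (induction I)
    case empty then show ?case by (simp add: h_zero)
  next
    case (insert i I)
    then have F: "F \<in> I \<rightarrow> carrier M" by auto
    with insert show ?case by (simp add: h h_add Pi_def)
  qed
qed

lemma (in abelian_monoid) finsum_lessThan_Suc:
  assumes "\<And>i. i < Suc n \<Longrightarrow> F i \<in> carrier G"
  shows "(\<Oplus>i\<in>{..<Suc n}. F i) = F n \<oplus> (\<Oplus>i\<in>{..<n}. F i)"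
  using assms by (subst lessThan_Suc, subst finsum_insert) (auto simp: Pi_def)

lemma (in abelian_monoid) finsum_lessThan_closed:
  assumes "\<And>i. i < n \<Longrightarrow> F i \<in> carrier G"
  shows "(\<Oplus>i\<in>{..<n}. F i) \<in> carrier G"
  using assms by (intro finsum_closed) auto

lemma (in abelian_monoid) finsum_lessThan_cong:
  assumes "\<And>i. i < n \<Longrightarrow> F i = G' i" and "\<And>i. i < n \<Longrightarrow> G' i \<in> carrier G"
  shows "(\<Oplus>i\<in>{..<n::nat}. F i) = (\<Oplus>i\<in>{..<n}. G' i)"
  using assms by (intro finsum_cong') auto

text \<open>A formal sum may repeat a pair. Folding over the multiset keeps multiplicities, which
  \<open>finsum\<close> over its set of elements would lose.\<close>

definition mset_sum :: "('a, 'm) ring_scheme \<Rightarrow> ('p \<Rightarrow> 'a) \<Rightarrow> 'p multiset \<Rightarrow> 'a" where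
  "mset_sum M g = fold_mset
    (\<lambda>p a. if g p \<in> carrier M \<and> a \<in> carrier M then g p \<oplus>\<^bsub>M\<^esub> a else a) \<zero>\<^bsub>M\<^esub>"

context abelian_monoid
begin

text \<open>The guard in \<^const>\<open>mset_sum\<close> makes the step function commute outside the carrier as well.\<close>

lemma comp_fun_commute_mset_sum:
  "comp_fun_commute (\<lambda>p a. if g p \<in> carrier G \<and> a \<in> carrier G then g p \<oplus> a else a)"
  by unfold_locales (auto simp: fun_eq_iff a_lcomm)

lemma mset_sum_empty: "mset_sum G g {#} = \<zero>"
  by (simp add: mset_sum_def)

lemma mset_sum_closed: "mset_sum G g u \<in> carrier G"
proof (induction u)
  case empty then show ?case by (simp add: mset_sum_def)
next
  case (add p u)
  interpret comp_fun_commute "\<lambda>p a. if g p \<in> carrier G \<and> a \<in> carrier G then g p \<oplus> a else a"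
    by (rule comp_fun_commute_mset_sum)
  from add show ?case by (simp add: mset_sum_def)
qed

lemma mset_sum_add_mset:
  assumes "g p \<in> carrier G"
  shows "mset_sum G g (add_mset p u) = g p \<oplus> mset_sum G g u"
proof -
  interpret comp_fun_commute "\<lambda>p a. if g p \<in> carrier G \<and> a \<in> carrier G then g p \<oplus> a else a"
    by (rule comp_fun_commute_mset_sum)
  show ?thesis using assms mset_sum_closed[of g u] by (simp add: mset_sum_def)
qed

lemma mset_sum_plus:
  assumes "\<And>p. p \<in># u \<Longrightarrow> g p \<in> carrier G"
  shows "mset_sum G g (u + v) = mset_sum G g u \<oplus> mset_sum G g v"
  using assms
  by (induction u) (simp_all add: mset_sum_empty mset_sum_closed mset_sum_add_mset a_assoc)

text \<open>Links formal sums to indexed sums. \<open>F\<close> may repeat values, and the multiset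
  image counts every occurrence, as the indexed sum does.\<close>

lemma mset_sum_image_mset_lessThan:
  fixes n :: nat
  assumes "\<And>i. i < n \<Longrightarrow> g (F i) \<in> carrier G"
  shows "mset_sum G g (image_mset F (mset_set {..<n})) = (\<Oplus>i\<in>{..<n}. g (F i))"
  using assms
proof (induction n)
  case 0 then show ?case by (simp add: mset_sum_empty)
next
  case (Suc n)
  then have "(\<Oplus>i\<in>{..<Suc n}. g (F i)) = g (F n) \<oplus> (\<Oplus>i\<in>{..<n}. g (F i))"
    by (intro finsum_lessThan_Suc) auto
  with Suc show ?case by (simp add: lessThan_Suc mset_sum_add_mset)
qed

end

section \<open>Balanced pairings\<close>

text \<open>Such an \<open>f\<close> corresponds to a bimodule homomorphism from the tensor product
  of \<open>X\<close> and \<open>Y\<close> over \<open>B\<close> to \<open>A\<close>; as a function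
  of two arguments it can be handled without congruence classes. Preservation of zero follows from
  linearity, since a zero vector is the zero scalar times itself.\<close>

locale balanced_pairing = X: semibimodule A B X + Y: semibimodule B A Y
  for A :: "('a, 'm) ring_scheme" and B :: "('b, 'p) ring_scheme"
    and X :: "('a, 'b, 'x, 'n) bimodule_scheme" and Y :: "('b, 'a, 'y, 'q) bimodule_scheme" +
  fixes f :: "'x \<Rightarrow> 'y \<Rightarrow> 'a"
  assumes closed: "\<lbrakk>x \<in> carrier X; y \<in> carrier Y\<rbrakk> \<Longrightarrow> f x y \<in> carrier A"
    and add_left: "\<lbrakk>x \<in> carrier X; x' \<in> carrier X; y \<in> carrier Y\<rbrakk> \<Longrightarrow>
      f (x \<oplus>\<^bsub>X\<^esub> x') y = f x y \<oplus>\<^bsub>A\<^esub> f x' y"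
    and add_right: "\<lbrakk>x \<in> carrier X; y \<in> carrier Y; y' \<in> carrier Y\<rbrakk> \<Longrightarrow>
      f x (y \<oplus>\<^bsub>Y\<^esub> y') = f x y \<oplus>\<^bsub>A\<^esub> f x y'"
    and lact: "\<lbrakk>a \<in> carrier A; x \<in> carrier X; y \<in> carrier Y\<rbrakk> \<Longrightarrow>
      f (a \<rightharpoonup>\<^bsub>X\<^esub> x) y = a \<otimes>\<^bsub>A\<^esub> f x y"
    and ract: "\<lbrakk>a \<in> carrier A; x \<in> carrier X; y \<in> carrier Y\<rbrakk> \<Longrightarrow>
      f x (y \<leftharpoonup>\<^bsub>Y\<^esub> a) = f x y \<otimes>\<^bsub>A\<^esub> a"
    and balanced: "\<lbrakk>x \<in> carrier X; b \<in> carrier B; y \<in> carrier Y\<rbrakk> \<Longrightarrow>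
      f (x \<leftharpoonup>\<^bsub>X\<^esub> b) y = f x (b \<rightharpoonup>\<^bsub>Y\<^esub> y)"
begin

lemma zero_left: "y \<in> carrier Y \<Longrightarrow> f \<zero>\<^bsub>X\<^esub> y = \<zero>\<^bsub>A\<^esub>"
  using lact[of "\<zero>\<^bsub>A\<^esub>" "\<zero>\<^bsub>X\<^esub>" y] by (simp add: X.lact_zero closed)

lemma zero_right: "x \<in> carrier X \<Longrightarrow> f x \<zero>\<^bsub>Y\<^esub> = \<zero>\<^bsub>A\<^esub>"
  using ract[of "\<zero>\<^bsub>A\<^esub>" x "\<zero>\<^bsub>Y\<^esub>"] by (simp add: Y.ract_zero closed)

lemma finsum_left:
  assumes "finite I" and "\<And>i. i \<in> I \<Longrightarrow> F i \<in> carrier X" and "y \<in> carrier Y"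
  shows "f (finsum X F I) y = (\<Oplus>\<^bsub>A\<^esub>i\<in>I. f (F i) y)"
  using assms
  by (intro finsum_additive[where h = "\<lambda>x. f x y"])
    (auto simp: closed add_left zero_left X.X.abelian_monoid_axioms X.A.abelian_monoid_axioms)

lemma finsum_right:
  assumes "finite I" and "\<And>i. i \<in> I \<Longrightarrow> F i \<in> carrier Y" and "x \<in> carrier X"
  shows "f x (finsum Y F I) = (\<Oplus>\<^bsub>A\<^esub>i\<in>I. f x (F i))"
  using assms
  by (intro finsum_additive[where h = "\<lambda>y. f x y"])
    (auto simp: closed add_right zero_right Y.X.abelian_monoid_axioms X.A.abelian_monoid_axioms)

end

section \<open>Compatibility of the scalar actions with finite sums\<close>

context left_semimodule
begin

lemma lact_zero_right: "a \<in> carrier A \<Longrightarrow> a \<rightharpoonup> \<zero> = \<zero>"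
  using lact_mult[of a "\<zero>\<^bsub>A\<^esub>" "\<zero>"] lact_zero[of "\<zero>"] by simp

lemma finsum_lact:
  assumes "finite I" and "\<And>i. i \<in> I \<Longrightarrow> F i \<in> carrier A" and "x \<in> carrier X"
  shows "(finsum A F I) \<rightharpoonup> x = (\<Oplus>i\<in>I. F i \<rightharpoonup> x)"
  using assms
  by (intro finsum_additive[where h = "\<lambda>a. a \<rightharpoonup> x"])
    (auto simp: lact_closed lact_add_left lact_zero X.abelian_monoid_axioms A.abelian_monoid_axioms)

lemma lact_finsum:
  assumes "finite I" and "\<And>i. i \<in> I \<Longrightarrow> F i \<in> carrier X" and "a \<in> carrier A"
  shows "a \<rightharpoonup> (finsum X F I) = (\<Oplus>i\<in>I. a \<rightharpoonup> F i)"
  using assms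
  by (intro finsum_additive[where h = "\<lambda>x. a \<rightharpoonup> x"])
    (auto simp: lact_closed lact_add_right lact_zero_right X.abelian_monoid_axioms)

end

context right_semimodule
begin

lemma ract_zero_left: "b \<in> carrier B \<Longrightarrow> \<zero> \<leftharpoonup> b = \<zero>"
  using ract_mult[of "\<zero>\<^bsub>B\<^esub>" b "\<zero>"] ract_zero[of "\<zero>"] by simp

lemma finsum_ract:
  assumes "finite I" and "\<And>i. i \<in> I \<Longrightarrow> F i \<in> carrier X" and "b \<in> carrier B"
  shows "(finsum X F I) \<leftharpoonup> b = (\<Oplus>i\<in>I. F i \<leftharpoonup> b)"
  using assms
  by (intro finsum_additive[where h = "\<lambda>x. x \<leftharpoonup> b"])
    (auto simp: ract_closed ract_add_left ract_zero_left X.abelian_monoid_axioms)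

lemma ract_finsum:
  assumes "finite I" and "\<And>i. i \<in> I \<Longrightarrow> F i \<in> carrier B" and "x \<in> carrier X"
  shows "x \<leftharpoonup> (finsum B F I) = (\<Oplus>i\<in>I. x \<leftharpoonup> F i)"
  using assms
  by (intro finsum_additive[where h = "\<lambda>b. x \<leftharpoonup> b"])
    (auto simp: ract_closed ract_add_right ract_zero X.abelian_monoid_axioms B.abelian_monoid_axioms)

end

section \<open>The pairing of a tensor product isomorphism\<close>

text \<open>This is the universal property of the tensor product, proved by rule induction: each
  generator of the congruence is one of the assumed laws of \<open>g\<close>. The monoid
  \<open>M\<close> is general because the maps to which this is applied later take values in
  \<open>X\<close> and not in a semiring.\<close>

lemma tensor_cong_mset_sum_eq:
  assumes "semibimodule A B X" and "semibimodule B C Y" and "abelian_monoid M"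
    and g: "\<And>x y. x \<in> carrier X \<Longrightarrow> y \<in> carrier Y \<Longrightarrow> g x y \<in> carrier M"
    and g_add_left: "\<And>x x' y. x \<in> carrier X \<Longrightarrow> x' \<in> carrier X \<Longrightarrow> y \<in> carrier Y \<Longrightarrow>
      g (x \<oplus>\<^bsub>X\<^esub> x') y = g x y \<oplus>\<^bsub>M\<^esub> g x' y"
    and g_add_right: "\<And>x y y'. x \<in> carrier X \<Longrightarrow> y \<in> carrier Y \<Longrightarrow> y' \<in> carrier Y \<Longrightarrow>
      g x (y \<oplus>\<^bsub>Y\<^esub> y') = g x y \<oplus>\<^bsub>M\<^esub> g x y'"
    and g_zero_left: "\<And>y. y \<in> carrier Y \<Longrightarrow> g \<zero>\<^bsub>X\<^esub> y = \<zero>\<^bsub>M\<^esub>"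
    and g_zero_right: "\<And>x. x \<in> carrier X \<Longrightarrow> g x \<zero>\<^bsub>Y\<^esub> = \<zero>\<^bsub>M\<^esub>"
    and g_balanced: "\<And>x b y. x \<in> carrier X \<Longrightarrow> b \<in> carrier B \<Longrightarrow> y \<in> carrier Y \<Longrightarrow>
      g (x \<leftharpoonup>\<^bsub>X\<^esub> b) y = g x (b \<rightharpoonup>\<^bsub>Y\<^esub> y)"
    and "(u, v) \<in> tensor_cong X B Y"
  shows "mset_sum M (case_prod g) u = mset_sum M (case_prod g) v"
proof -
  interpret X: semibimodule A B X by fact
  interpret Y: semibimodule B C Y by fact
  interpret M: abelian_monoid M by fact
  have F: "case_prod g p \<in> carrier M" if "u \<in> formal_sums X Y" "p \<in># u" for p u
    using that g by (auto simp: formal_sums_def)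
  note sums = M.mset_sum_add_mset M.mset_sum_empty
  show ?thesis
    using assms(10)
  proof induction
    case (plus u v u' v')
    then have "u \<in> formal_sums X Y" "v \<in> formal_sums X Y"
      using tensor_cong_formal_sums[OF assms(1,2)] by blast+
    with plus show ?case by (simp add: M.mset_sum_plus F)
  qed (simp_all add: sums g g_add_left g_add_right g_zero_left g_zero_right g_balanced
      X.ract_closed Y.lact_closed)
qed

locale tensor_iso = X: semibimodule A B X + Y: semibimodule B A Y
  for A :: "('a, 'm) ring_scheme" and B :: "('b, 'p) ring_scheme"
    and X :: "('a, 'b, 'x, 'n) bimodule_scheme" and Y :: "('b, 'a, 'y, 'q) bimodule_scheme" +
  fixes h :: "('x \<times> 'y) multiset set \<Rightarrow> 'a"
  assumes iso: "h \<in> bimodule_iso A A (tensor X B Y) (regular_bimodule A)"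
begin

section \<open>Congruence classes and the bimodule operations on them\<close>

definition cls :: "('x \<times> 'y) multiset \<Rightarrow> ('x \<times> 'y) multiset set" where
  "cls u = tensor_cong X B Y `` {u}"

definition pairing :: "'x \<Rightarrow> 'y \<Rightarrow> 'a" where
  "pairing x y = h (cls {#(x, y)#})"

sublocale T: semibimodule A A "tensor X B Y"
  by (rule semibimodule_tensor) unfold_locales

lemma equiv_cong: "equiv (formal_sums X Y) (tensor_cong X B Y)"
  by (rule equiv_tensor_cong) unfold_locales

lemma carrier_tensor: "carrier (tensor X B Y) = formal_sums X Y // tensor_cong X B Y"
  by (simp add: tensor_def)

lemma cls_closed: "u \<in> formal_sums X Y \<Longrightarrow> cls u \<in> carrier (tensor X B Y)"
  by (simp add: carrier_tensor cls_def quotientI)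

lemma in_cls_self: "u \<in> formal_sums X Y \<Longrightarrow> u \<in> cls u"
  by (simp add: cls_def tensor_cong.refl)

lemma cls_eq_iff:
  "u \<in> formal_sums X Y \<Longrightarrow> v \<in> formal_sums X Y \<Longrightarrow> cls u = cls v \<longleftrightarrow> (u, v) \<in> tensor_cong X B Y"
  unfolding cls_def by (rule eq_equiv_class_iff[OF equiv_cong])

text \<open>Operations on classes are unions over all representatives. Once closure puts a result in
  the carrier, a single member identifies it, so the three computations that follow need no second
  proof of well-definedness.\<close>

lemma class_eq_cls: "P \<in> carrier (tensor X B Y) \<Longrightarrow> u \<in> P \<Longrightarrow> P = cls u"
  using equiv_cong by (force simp: carrier_tensor cls_def elim!: quotientE dest: equiv_class_eq)

lemma single_formal_sum: "{#(x, y)#} \<in> formal_sums X Y \<longleftrightarrow> x \<in> carrier X \<and> y \<in> carrier Y"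
  by (simp add: formal_sums_def)

lemma cls_plus:
  assumes "u \<in> formal_sums X Y" "v \<in> formal_sums X Y"
  shows "cls u \<oplus>\<^bsub>tensor X B Y\<^esub> cls v = cls (u + v)"
proof (rule class_eq_cls)
  show "cls u \<oplus>\<^bsub>tensor X B Y\<^esub> cls v \<in> carrier (tensor X B Y)"
    using assms by (simp add: cls_closed)
  have "u + v \<in> cls (u + v)" "u \<in> cls u" "v \<in> cls v"
    using assms by (simp_all add: in_cls_self formal_sums_plus)
  then show "u + v \<in> cls u \<oplus>\<^bsub>tensor X B Y\<^esub> cls v"
    by (auto simp: tensor_def cls_def)
qed

lemma lact_cls_single:
  assumes "a \<in> carrier A" "x \<in> carrier X" "y \<in> carrier Y"
  shows "a \<rightharpoonup>\<^bsub>tensor X B Y\<^esub> cls {#(x, y)#} = cls {#(a \<rightharpoonup>\<^bsub>X\<^esub> x, y)#}"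
proof (rule class_eq_cls)
  show "a \<rightharpoonup>\<^bsub>tensor X B Y\<^esub> cls {#(x, y)#} \<in> carrier (tensor X B Y)"
    using assms by (intro T.lact_closed cls_closed) (simp_all add: single_formal_sum)
  have "{#(x, y)#} \<in> cls {#(x, y)#}" "{#(a \<rightharpoonup>\<^bsub>X\<^esub> x, y)#} \<in> cls {#(a \<rightharpoonup>\<^bsub>X\<^esub> x, y)#}"
    using assms by (simp_all add: in_cls_self single_formal_sum X.lact_closed)
  then show "{#(a \<rightharpoonup>\<^bsub>X\<^esub> x, y)#} \<in> a \<rightharpoonup>\<^bsub>tensor X B Y\<^esub> cls {#(x, y)#}"
    by (auto simp: tensor_def cls_def intro!: bexI[of _ "{#(x, y)#}"])
qed

lemma ract_cls_single:
  assumes "a \<in> carrier A" "x \<in> carrier X" "y \<in> carrier Y"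
  shows "cls {#(x, y)#} \<leftharpoonup>\<^bsub>tensor X B Y\<^esub> a = cls {#(x, y \<leftharpoonup>\<^bsub>Y\<^esub> a)#}"
proof (rule class_eq_cls)
  show "cls {#(x, y)#} \<leftharpoonup>\<^bsub>tensor X B Y\<^esub> a \<in> carrier (tensor X B Y)"
    using assms by (intro T.ract_closed cls_closed) (simp_all add: single_formal_sum)
  have "{#(x, y)#} \<in> cls {#(x, y)#}" "{#(x, y \<leftharpoonup>\<^bsub>Y\<^esub> a)#} \<in> cls {#(x, y \<leftharpoonup>\<^bsub>Y\<^esub> a)#}"
    using assms by (simp_all add: in_cls_self single_formal_sum Y.ract_closed)
  then show "{#(x, y \<leftharpoonup>\<^bsub>Y\<^esub> a)#} \<in> cls {#(x, y)#} \<leftharpoonup>\<^bsub>tensor X B Y\<^esub> a"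
    by (auto simp: tensor_def cls_def intro!: bexI[of _ "{#(x, y)#}"])
qed

lemma h_closed: "P \<in> carrier (tensor X B Y) \<Longrightarrow> h P \<in> carrier A"
  and h_add: "P \<in> carrier (tensor X B Y) \<Longrightarrow> Q \<in> carrier (tensor X B Y) \<Longrightarrow>
    h (P \<oplus>\<^bsub>tensor X B Y\<^esub> Q) = h P \<oplus>\<^bsub>A\<^esub> h Q"
  and h_lact: "a \<in> carrier A \<Longrightarrow> P \<in> carrier (tensor X B Y) \<Longrightarrow>
    h (a \<rightharpoonup>\<^bsub>tensor X B Y\<^esub> P) = a \<otimes>\<^bsub>A\<^esub> h P"
  and h_ract: "a \<in> carrier A \<Longrightarrow> P \<in> carrier (tensor X B Y) \<Longrightarrow>
    h (P \<leftharpoonup>\<^bsub>tensor X B Y\<^esub> a) = h P \<otimes>\<^bsub>A\<^esub> a"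
  and h_bij: "bij_betw h (carrier (tensor X B Y)) (carrier A)"
  using iso by (auto simp: bimodule_iso_def bimodule_hom_def regular_bimodule_def)

text \<open>Zero comes from left linearity: the zero tensor is the scalar zero acting on itself, and
  \<open>h\<close> turns this action into multiplication by zero.\<close>

lemma h_cls_empty: "h (cls {#}) = \<zero>\<^bsub>A\<^esub>"
proof -
  have 0: "cls {#} = \<zero>\<^bsub>tensor X B Y\<^esub>" by (simp add: cls_def tensor_def)
  have "h (\<zero>\<^bsub>A\<^esub> \<rightharpoonup>\<^bsub>tensor X B Y\<^esub> \<zero>\<^bsub>tensor X B Y\<^esub>) = \<zero>\<^bsub>A\<^esub>"
    by (simp add: h_lact h_closed)
  then show ?thesis by (simp add: 0 T.lact_zero)
qed

sublocale pairing: balanced_pairing A B X Y pairing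
proof
  note [simp] = single_formal_sum X.ract_closed X.lact_closed Y.lact_closed Y.ract_closed
  \<comment> \<open>Together with the generators of the congruence, additivity of \<open>h\<close>
    on a sum of two generators gives additivity of \<open>pairing\<close> in each argument.\<close>
  have two: "h (cls {#p, q#}) = h (cls {#p#}) \<oplus>\<^bsub>A\<^esub> h (cls {#q#})"
    if "{#p#} \<in> formal_sums X Y" "{#q#} \<in> formal_sums X Y" for p q
    using that cls_plus[of "{#p#}" "{#q#}"] h_add[of "cls {#p#}" "cls {#q#}"]
    by (simp add: cls_closed add_mset_commute)
  have two_formal: "{#p, q#} \<in> formal_sums X Y"
    if "{#p#} \<in> formal_sums X Y" "{#q#} \<in> formal_sums X Y" for p q
    using that by (simp add: formal_sums_def)
  fix x y assume xy: "x \<in> carrier X" "y \<in> carrier Y"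
  show "pairing x y \<in> carrier A"
    using xy by (simp add: pairing_def h_closed cls_closed)
  show "pairing (x \<oplus>\<^bsub>X\<^esub> x') y = pairing x y \<oplus>\<^bsub>A\<^esub> pairing x' y" if "x' \<in> carrier X" for x'
    using xy that two[of "(x, y)" "(x', y)"] tensor_cong.add_left[of x X x' y Y B]
    by (simp add: pairing_def cls_eq_iff[symmetric] two_formal)
  show "pairing x (y \<oplus>\<^bsub>Y\<^esub> y') = pairing x y \<oplus>\<^bsub>A\<^esub> pairing x y'" if "y' \<in> carrier Y" for y'
    using xy that two[of "(x, y)" "(x, y')"] tensor_cong.add_right[of x X y Y y' B]
    by (simp add: pairing_def cls_eq_iff[symmetric] two_formal)
  show "pairing (a \<rightharpoonup>\<^bsub>X\<^esub> x) y = a \<otimes>\<^bsub>A\<^esub> pairing x y" if "a \<in> carrier A" for a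
    using xy that by (simp add: pairing_def lact_cls_single[symmetric] h_lact cls_closed)
  show "pairing x (y \<leftharpoonup>\<^bsub>Y\<^esub> a) = pairing x y \<otimes>\<^bsub>A\<^esub> a" if "a \<in> carrier A" for a
    using xy that by (simp add: pairing_def ract_cls_single[symmetric] h_ract cls_closed)
  show "pairing (x \<leftharpoonup>\<^bsub>X\<^esub> b) y = pairing x (b \<rightharpoonup>\<^bsub>Y\<^esub> y)" if "b \<in> carrier B" for b
    using xy that tensor_cong.balanced[of x X b B y Y]
    by (simp add: pairing_def cls_eq_iff[symmetric])
qed

lemma h_cls:
  fixes n :: nat
  assumes "\<And>i. i < n \<Longrightarrow> x i \<in> carrier X" "\<And>i. i < n \<Longrightarrow> y i \<in> carrier Y"
  shows "h (cls {#(x i, y i). i \<in># mset_set {..<n}#}) = (\<Oplus>\<^bsub>A\<^esub>i\<in>{..<n}. pairing (x i) (y i))"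
  using assms
proof (induction n)
  case 0 then show ?case by (simp add: h_cls_empty)
next
  case (Suc n)
  let ?u = "{#(x i, y i). i \<in># mset_set {..<n}#}"
  have F: "?u \<in> formal_sums X Y" "{#(x n, y n)#} \<in> formal_sums X Y"
    using Suc.prems by (auto simp: formal_sums_def)
  have "h (cls ({#(x n, y n)#} + ?u)) = pairing (x n) (y n) \<oplus>\<^bsub>A\<^esub> (\<Oplus>\<^bsub>A\<^esub>i\<in>{..<n}. pairing (x i) (y i))"
    unfolding cls_plus[OF F(2,1), symmetric] using F Suc
    by (simp add: h_add cls_closed pairing_def)
  also have "\<dots> = (\<Oplus>\<^bsub>A\<^esub>i\<in>{..<Suc n}. pairing (x i) (y i))"
    using Suc.prems by (intro X.A.finsum_lessThan_Suc[symmetric] pairing.closed) auto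
  finally show ?case by (simp add: lessThan_Suc)
qed

text \<open>Injectivity of \<open>h\<close> turns equal sums of \<open>pairing\<close> values into
  congruent formal sums, which a biadditive balanced map cannot distinguish. Identities in
  \<open>A\<close> can thus be transported to any such map; this is how the two tensor isomorphisms
  get compared.\<close>

lemma finsum_eq_if_finsum_pairing_eq:
  fixes n m :: nat
  assumes xy: "\<And>i. i < n \<Longrightarrow> x i \<in> carrier X" "\<And>i. i < n \<Longrightarrow> y i \<in> carrier Y"
    and xy': "\<And>i. i < m \<Longrightarrow> x' i \<in> carrier X" "\<And>i. i < m \<Longrightarrow> y' i \<in> carrier Y"
    and eq: "(\<Oplus>\<^bsub>A\<^esub>i\<in>{..<n}. pairing (x i) (y i)) = (\<Oplus>\<^bsub>A\<^esub>i\<in>{..<m}. pairing (x' i) (y' i))"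
    and M: "abelian_monoid M"
    and g: "\<And>x y. x \<in> carrier X \<Longrightarrow> y \<in> carrier Y \<Longrightarrow> g x y \<in> carrier M"
    and g': "\<And>x x' y. x \<in> carrier X \<Longrightarrow> x' \<in> carrier X \<Longrightarrow> y \<in> carrier Y \<Longrightarrow>
      g (x \<oplus>\<^bsub>X\<^esub> x') y = g x y \<oplus>\<^bsub>M\<^esub> g x' y"
      "\<And>x y y'. x \<in> carrier X \<Longrightarrow> y \<in> carrier Y \<Longrightarrow> y' \<in> carrier Y \<Longrightarrow>
      g x (y \<oplus>\<^bsub>Y\<^esub> y') = g x y \<oplus>\<^bsub>M\<^esub> g x y'"
      "\<And>y. y \<in> carrier Y \<Longrightarrow> g \<zero>\<^bsub>X\<^esub> y = \<zero>\<^bsub>M\<^esub>"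
      "\<And>x. x \<in> carrier X \<Longrightarrow> g x \<zero>\<^bsub>Y\<^esub> = \<zero>\<^bsub>M\<^esub>"
      "\<And>x b y. x \<in> carrier X \<Longrightarrow> b \<in> carrier B \<Longrightarrow> y \<in> carrier Y \<Longrightarrow>
      g (x \<leftharpoonup>\<^bsub>X\<^esub> b) y = g x (b \<rightharpoonup>\<^bsub>Y\<^esub> y)"
  shows "(\<Oplus>\<^bsub>M\<^esub>i\<in>{..<n}. g (x i) (y i)) = (\<Oplus>\<^bsub>M\<^esub>i\<in>{..<m}. g (x' i) (y' i))"
proof -
  interpret M: abelian_monoid M by fact
  let ?u = "{#(x i, y i). i \<in># mset_set {..<n}#}" and ?v = "{#(x' i, y' i). i \<in># mset_set {..<m}#}"
  have F: "?u \<in> formal_sums X Y" "?v \<in> formal_sums X Y"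
    using xy xy' by (auto simp: formal_sums_def)
  have "h (cls ?u) = h (cls ?v)"
    using eq by (simp add: h_cls xy xy')
  then have "cls ?u = cls ?v"
    using h_bij F by (auto simp: bij_betw_def cls_closed dest: inj_onD)
  then have "(?u, ?v) \<in> tensor_cong X B Y"
    using F by (simp add: cls_eq_iff)
  then have "mset_sum M (case_prod g) ?u = mset_sum M (case_prod g) ?v"
    using tensor_cong_mset_sum_eq[OF X.semibimodule_axioms Y.semibimodule_axioms M g g'] by blast
  then show ?thesis
    by (simp add: M.mset_sum_image_mset_lessThan g xy xy')
qed

text \<open>Surjectivity of \<open>h\<close> yields a tensor mapped to one; listing the pairs of a
  representative gives the two families.\<close>

lemma one_decomposition:
  obtains n :: nat and x y where "n > 0" and "\<And>i. i < n \<Longrightarrow> x i \<in> carrier X"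
    and "\<And>i. i < n \<Longrightarrow> y i \<in> carrier Y" and "(\<Oplus>\<^bsub>A\<^esub>i\<in>{..<n}. pairing (x i) (y i)) = \<one>\<^bsub>A\<^esub>"
proof -
  obtain P where P: "P \<in> carrier (tensor X B Y)" "h P = \<one>\<^bsub>A\<^esub>"
    using h_bij X.A.one_closed by (metis bij_betw_imp_surj_on imageE)
  then obtain u where u: "u \<in> formal_sums X Y" "P = cls u"
    by (auto simp: carrier_tensor cls_def elim: quotientE)
  obtain ps where ps: "mset ps = u" by (metis ex_mset)
  \<comment> \<open>The pair of zeros keeps the length positive even if the representative is the
    empty sum, which can occur when one equals zero. Its pairing is zero, so the value does not
    change.\<close>
  define qs where "qs = (\<zero>\<^bsub>X\<^esub>, \<zero>\<^bsub>Y\<^esub>) # ps"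
  define n where "n = length qs"
  have mem: "fst (qs ! i) \<in> carrier X" "snd (qs ! i) \<in> carrier Y" if "i < n" for i
  proof -
    have "qs ! i \<in> set qs" using that by (simp add: n_def)
    moreover have "set qs \<subseteq> carrier X \<times> carrier Y"
      using u(1) ps by (auto simp: qs_def formal_sums_def)
    ultimately have "qs ! i \<in> carrier X \<times> carrier Y" by blast
    then show "fst (qs ! i) \<in> carrier X" "snd (qs ! i) \<in> carrier Y" by auto
  qed
  have z: "{#(\<zero>\<^bsub>X\<^esub>, \<zero>\<^bsub>Y\<^esub>)#} \<in> formal_sums X Y" by (simp add: single_formal_sum)
  have "mset qs = {#(fst (qs ! i), snd (qs ! i)). i \<in># mset_set {..<n}#}"
    using mset_map[of "(!) qs" "[0..<n]"] by (simp add: n_def map_nth atLeast0LessThan)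
  then have "(\<Oplus>\<^bsub>A\<^esub>i\<in>{..<n}. pairing (fst (qs ! i)) (snd (qs ! i))) = h (cls (mset qs))"
    using h_cls[of n "\<lambda>i. fst (qs ! i)" "\<lambda>i. snd (qs ! i)"] mem by simp
  also have "mset qs = {#(\<zero>\<^bsub>X\<^esub>, \<zero>\<^bsub>Y\<^esub>)#} + u" by (simp add: qs_def ps)
  also have "h (cls \<dots>) = pairing \<zero>\<^bsub>X\<^esub> \<zero>\<^bsub>Y\<^esub> \<oplus>\<^bsub>A\<^esub> h (cls u)"
    unfolding cls_plus[OF z u(1), symmetric] using z u(1) by (simp add: h_add cls_closed pairing_def)
  also have "\<dots> = \<one>\<^bsub>A\<^esub>" using P u by (simp add: pairing.zero_left)
  finally show ?thesis using mem by (intro that[of n]) (auto simp: n_def qs_def)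
qed

end

section \<open>Morita contexts\<close>

text \<open>\<open>compat\<close> is an associativity law: the two ways to bracket a product of
  \<open>x\<close>, \<open>y\<close> and \<open>x'\<close> agree.\<close>

locale morita_context = f: balanced_pairing K S X Y f + g: balanced_pairing S K Y X g
  for K :: "('k, 'm) ring_scheme" and S :: "('s, 'n) ring_scheme"
    and X :: "('k, 's, 'x, 'p) bimodule_scheme" and Y :: "('s, 'k, 'y, 'q) bimodule_scheme"
    and f :: "'x \<Rightarrow> 'y \<Rightarrow> 'k" and g :: "'y \<Rightarrow> 'x \<Rightarrow> 's" +
  assumes compat: "\<lbrakk>x \<in> carrier X; y \<in> carrier Y; x' \<in> carrier X\<rbrakk> \<Longrightarrow>
    f x y \<rightharpoonup>\<^bsub>X\<^esub> x' = x \<leftharpoonup>\<^bsub>X\<^esub> g y x'"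

text \<open>
  Two isomorphisms \<open>X \<otimes> Y \<cong> K\<close> and \<open>Y \<otimes> X \<cong> S\<close> need not be compatible. They differ by the bimodule
  automorphism \<open>\<alpha>\<close> of \<open>X\<close> with \<open>\<alpha> (f x y \<rightharpoonup> x') = x \<leftharpoonup> g y x'\<close>, and composing \<open>g\<close> with its inverse \<open>\<beta>\<close>
  in the second argument makes them compatible.
\<close>

lemma morita_context_of_tensor_isos:
  fixes K :: "('k, 'm) ring_scheme" and S :: "('s, 'n) ring_scheme"
    and X :: "('k, 's, 'x, 'p) bimodule_scheme" and Y :: "('s, 'k, 'y, 'q) bimodule_scheme"
  assumes "tensor_iso K S X Y h" and "tensor_iso S K Y X h'"
  obtains f g and n N :: nat and x y u v where "morita_context K S X Y f g" and "n > 0"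
    and "\<And>i. i < n \<Longrightarrow> x i \<in> carrier X" and "\<And>i. i < n \<Longrightarrow> y i \<in> carrier Y"
    and "(\<Oplus>\<^bsub>S\<^esub>i\<in>{..<n}. g (y i) (x i)) = \<one>\<^bsub>S\<^esub>"
    and "\<And>i. i < N \<Longrightarrow> u i \<in> carrier X" and "\<And>i. i < N \<Longrightarrow> v i \<in> carrier Y"
    and "(\<Oplus>\<^bsub>K\<^esub>i\<in>{..<N}. f (u i) (v i)) = \<one>\<^bsub>K\<^esub>"
proof -
  interpret F: tensor_iso K S X Y h by fact
  interpret G: tensor_iso S K Y X h' by fact
  define f where "f = F.pairing"
  define g where "g = G.pairing"
  interpret f: balanced_pairing K S X Y f
    unfolding f_def by (rule F.pairing.balanced_pairing_axioms)
  interpret g: balanced_pairing S K Y X g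
    unfolding g_def by (rule G.pairing.balanced_pairing_axioms)
  obtain N :: nat and u v where "N > 0"
    and uv: "\<And>i. i < N \<Longrightarrow> u i \<in> carrier X" "\<And>i. i < N \<Longrightarrow> v i \<in> carrier Y"
    and uv_one: "(\<Oplus>\<^bsub>K\<^esub>i\<in>{..<N}. f (u i) (v i)) = \<one>\<^bsub>K\<^esub>"
    using F.one_decomposition[folded f_def] by blast
  obtain n :: nat and y x where "n > 0"
    and yx: "\<And>i. i < n \<Longrightarrow> y i \<in> carrier Y" "\<And>i. i < n \<Longrightarrow> x i \<in> carrier X"
    and yx_one: "(\<Oplus>\<^bsub>S\<^esub>i\<in>{..<n}. g (y i) (x i)) = \<one>\<^bsub>S\<^esub>"
    using G.one_decomposition[folded g_def] by blast
  note closed [simp] = f.closed g.closed F.X.lact_closed F.X.ract_closed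
    F.Y.lact_closed F.Y.ract_closed uv yx
  \<comment> \<open>The formula is forced by the intended rule \<open>f x y \<rightharpoonup> x'
    \<mapsto> x \<leftharpoonup> g y x'\<close>: write \<open>z\<close> as one acting on
    \<open>z\<close> and expand one by \<open>uv_one\<close>.\<close>
  define \<alpha> where "\<alpha> z = (\<Oplus>\<^bsub>X\<^esub>i\<in>{..<N}. u i \<leftharpoonup>\<^bsub>X\<^esub> g (v i) z)" for z
  \<comment> \<open>The inverse rule, applied to \<open>z\<close> acted on by one from the right,
    with one expanded by \<open>yx_one\<close>, leads to this formula.\<close>
  define \<beta> where "\<beta> z = (\<Oplus>\<^bsub>X\<^esub>j\<in>{..<n}. f z (y j) \<rightharpoonup>\<^bsub>X\<^esub> x j)" for z
  have \<alpha>_closed [simp]: "\<alpha> z \<in> carrier X" if "z \<in> carrier X" for z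
    unfolding \<alpha>_def using that by (intro F.X.X.finsum_lessThan_closed) simp
  have \<beta>_closed [simp]: "\<beta> z \<in> carrier X" if "z \<in> carrier X" for z
    unfolding \<beta>_def using that by (intro F.X.X.finsum_lessThan_closed) simp
  have \<alpha>_add: "\<alpha> (z \<oplus>\<^bsub>X\<^esub> z') = \<alpha> z \<oplus>\<^bsub>X\<^esub> \<alpha> z'" if "z \<in> carrier X" "z' \<in> carrier X" for z z'
    unfolding \<alpha>_def using that
    by (subst F.X.X.finsum_addf[symmetric]; (intro F.X.X.finsum_lessThan_cong)?)
      (auto simp: g.add_right F.X.ract_add_right)
  have \<alpha>_zero: "\<alpha> \<zero>\<^bsub>X\<^esub> = \<zero>\<^bsub>X\<^esub>"
    unfolding \<alpha>_def
    by (subst F.X.X.finsum_lessThan_cong[where G' = "\<lambda>_. \<zero>\<^bsub>X\<^esub>"])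
      (simp_all add: g.zero_right F.X.ract_zero)
  have \<alpha>_ract: "\<alpha> (z \<leftharpoonup>\<^bsub>X\<^esub> s) = \<alpha> z \<leftharpoonup>\<^bsub>X\<^esub> s" if "z \<in> carrier X" "s \<in> carrier S" for z s
    unfolding \<alpha>_def using that
    by (subst F.X.finsum_ract) (auto simp: g.ract F.X.ract_mult intro!: F.X.X.finsum_lessThan_cong)
  have \<beta>_add: "\<beta> (z \<oplus>\<^bsub>X\<^esub> z') = \<beta> z \<oplus>\<^bsub>X\<^esub> \<beta> z'" if "z \<in> carrier X" "z' \<in> carrier X" for z z'
    unfolding \<beta>_def using that
    by (subst F.X.X.finsum_addf[symmetric]; (intro F.X.X.finsum_lessThan_cong)?)
      (auto simp: f.add_left F.X.lact_add_left)
  have \<beta>_zero: "\<beta> \<zero>\<^bsub>X\<^esub> = \<zero>\<^bsub>X\<^esub>"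
    unfolding \<beta>_def
    by (subst F.X.X.finsum_lessThan_cong[where G' = "\<lambda>_. \<zero>\<^bsub>X\<^esub>"])
      (simp_all add: f.zero_left F.X.lact_zero)
  have \<beta>_lact: "\<beta> (k \<rightharpoonup>\<^bsub>X\<^esub> z) = k \<rightharpoonup>\<^bsub>X\<^esub> \<beta> z" if "z \<in> carrier X" "k \<in> carrier K" for z k
    unfolding \<beta>_def using that
    by (subst F.X.lact_finsum) (auto simp: f.lact F.X.lact_mult intro!: F.X.X.finsum_lessThan_cong)
  have \<alpha>_pairing: "\<alpha> (f a b \<rightharpoonup>\<^bsub>X\<^esub> z) = a \<leftharpoonup>\<^bsub>X\<^esub> g b z"
    if ab: "a \<in> carrier X" "b \<in> carrier Y" and z: "z \<in> carrier X" for a b z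
  proof -
    \<comment> \<open>The right-hand side is a one-term sum so that both sides have the indexed form
      required for transport.\<close>
    have eq: "(\<Oplus>\<^bsub>K\<^esub>i\<in>{..<N}. f (u i) (v i \<leftharpoonup>\<^bsub>Y\<^esub> f a b)) = (\<Oplus>\<^bsub>K\<^esub>i\<in>{..<1::nat}. f a b)"
    proof -
      have "(\<Oplus>\<^bsub>K\<^esub>i\<in>{..<N}. f (u i) (v i \<leftharpoonup>\<^bsub>Y\<^esub> f a b)) = (\<Oplus>\<^bsub>K\<^esub>i\<in>{..<N}. f (u i) (v i) \<otimes>\<^bsub>K\<^esub> f a b)"
        using ab by (intro F.X.A.finsum_lessThan_cong) (auto simp: f.ract)
      also have "\<dots> = f a b"
        using ab by (subst F.X.A.finsum_ldistr[symmetric]) (auto simp: uv_one)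
      finally show ?thesis using ab by (simp add: lessThan_Suc)
    qed
    \<comment> \<open>Balancing moves \<open>f a b\<close> onto \<open>v i\<close>. Then
      \<open>eq\<close> is transported along the balanced map that sends \<open>x\<close> and
      \<open>y\<close> to \<open>x \<leftharpoonup> g y z\<close>.\<close>
    have "\<alpha> (f a b \<rightharpoonup>\<^bsub>X\<^esub> z) = (\<Oplus>\<^bsub>X\<^esub>i\<in>{..<N}. u i \<leftharpoonup>\<^bsub>X\<^esub> g (v i \<leftharpoonup>\<^bsub>Y\<^esub> f a b) z)"
      unfolding \<alpha>_def using ab z by (intro F.X.X.finsum_lessThan_cong) (auto simp: g.balanced)
    also have "\<dots> = (\<Oplus>\<^bsub>X\<^esub>i\<in>{..<1::nat}. a \<leftharpoonup>\<^bsub>X\<^esub> g b z)"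
      by (rule F.finsum_eq_if_finsum_pairing_eq[where g = "\<lambda>x y. x \<leftharpoonup>\<^bsub>X\<^esub> g y z", folded f_def, OF _ _ _ _ eq])
        (use ab z in \<open>auto simp: F.X.X.abelian_monoid_axioms F.X.ract_add_left F.X.ract_add_right
          g.add_left F.X.ract_zero_left g.zero_left F.X.ract_zero F.X.ract_mult g.lact\<close>)
    finally show ?thesis using ab z by (simp add: lessThan_Suc)
  qed
  have \<beta>_pairing: "\<beta> (a \<leftharpoonup>\<^bsub>X\<^esub> g b z) = f a b \<rightharpoonup>\<^bsub>X\<^esub> z"
    if ab: "a \<in> carrier X" "b \<in> carrier Y" and z: "z \<in> carrier X" for a b z
  proof -
    have eq: "(\<Oplus>\<^bsub>S\<^esub>j\<in>{..<n}. g (g b z \<rightharpoonup>\<^bsub>Y\<^esub> y j) (x j)) = (\<Oplus>\<^bsub>S\<^esub>j\<in>{..<1::nat}. g b z)"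
    proof -
      have "(\<Oplus>\<^bsub>S\<^esub>j\<in>{..<n}. g (g b z \<rightharpoonup>\<^bsub>Y\<^esub> y j) (x j)) = (\<Oplus>\<^bsub>S\<^esub>j\<in>{..<n}. g b z \<otimes>\<^bsub>S\<^esub> g (y j) (x j))"
        using ab z by (intro F.X.B.finsum_lessThan_cong) (auto simp: g.lact)
      also have "\<dots> = g b z"
        using ab z by (subst F.X.B.finsum_rdistr[symmetric]) (auto simp: yx_one)
      finally show ?thesis using ab z by (simp add: lessThan_Suc)
    qed
    \<comment> \<open>The mirror image: the identity now lives in \<open>S\<close>, and the balanced
      map sends \<open>y\<close> and \<open>x\<close> to
      \<open>f a y \<rightharpoonup> x\<close>.\<close>
    have "\<beta> (a \<leftharpoonup>\<^bsub>X\<^esub> g b z) = (\<Oplus>\<^bsub>X\<^esub>j\<in>{..<n}. f a (g b z \<rightharpoonup>\<^bsub>Y\<^esub> y j) \<rightharpoonup>\<^bsub>X\<^esub> x j)"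
      unfolding \<beta>_def using ab z by (intro F.X.X.finsum_lessThan_cong) (auto simp: f.balanced)
    also have "\<dots> = (\<Oplus>\<^bsub>X\<^esub>j\<in>{..<1::nat}. f a b \<rightharpoonup>\<^bsub>X\<^esub> z)"
      by (rule G.finsum_eq_if_finsum_pairing_eq[where g = "\<lambda>y x. f a y \<rightharpoonup>\<^bsub>X\<^esub> x", folded g_def, OF _ _ _ _ eq])
        (use ab z in \<open>auto simp: F.X.X.abelian_monoid_axioms F.X.lact_add_left F.X.lact_add_right
          f.add_right F.X.lact_zero_right f.zero_right F.X.lact_zero F.X.lact_mult f.ract\<close>)
    finally show ?thesis using ab z by (simp add: lessThan_Suc)
  qed
  \<comment> \<open>Every term of \<open>\<beta> z\<close> has the shape covered by
    \<open>\<alpha>_pairing\<close>, so the sum collapses to \<open>z\<close> acted on by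
    one.\<close>
  have \<alpha>\<beta>: "\<alpha> (\<beta> z) = z" if z: "z \<in> carrier X" for z
  proof -
    have "\<alpha> (\<beta> z) = (\<Oplus>\<^bsub>X\<^esub>j\<in>{..<n}. \<alpha> (f z (y j) \<rightharpoonup>\<^bsub>X\<^esub> x j))"
      unfolding \<beta>_def using z
      by (intro finsum_additive[where h = \<alpha>]) (auto simp: F.X.X.abelian_monoid_axioms \<alpha>_add \<alpha>_zero)
    also have "\<dots> = (\<Oplus>\<^bsub>X\<^esub>j\<in>{..<n}. z \<leftharpoonup>\<^bsub>X\<^esub> g (y j) (x j))"
      using z by (intro F.X.X.finsum_lessThan_cong) (auto simp: \<alpha>_pairing)
    also have "\<dots> = z"
      using z by (subst F.X.ract_finsum[symmetric]) (auto simp: yx_one F.X.ract_one)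
    finally show ?thesis .
  qed
  have \<beta>\<alpha>: "\<beta> (\<alpha> z) = z" if z: "z \<in> carrier X" for z
  proof -
    have "\<beta> (\<alpha> z) = (\<Oplus>\<^bsub>X\<^esub>i\<in>{..<N}. \<beta> (u i \<leftharpoonup>\<^bsub>X\<^esub> g (v i) z))"
      unfolding \<alpha>_def using z
      by (intro finsum_additive[where h = \<beta>]) (auto simp: F.X.X.abelian_monoid_axioms \<beta>_add \<beta>_zero)
    also have "\<dots> = (\<Oplus>\<^bsub>X\<^esub>i\<in>{..<N}. f (u i) (v i) \<rightharpoonup>\<^bsub>X\<^esub> z)"
      using z by (intro F.X.X.finsum_lessThan_cong) (auto simp: \<beta>_pairing)
    also have "\<dots> = z"
      using z by (subst F.X.finsum_lact[symmetric]) (auto simp: uv_one F.X.lact_one)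
    finally show ?thesis .
  qed
  \<comment> \<open>The formula for \<open>\<alpha>\<close> shows right linearity and the one for
    \<open>\<beta>\<close> shows left linearity. Right linearity of \<open>\<beta>\<close> is
    inherited from \<open>\<alpha>\<close> through inversion.\<close>
  have \<beta>_ract: "\<beta> (z \<leftharpoonup>\<^bsub>X\<^esub> s) = \<beta> z \<leftharpoonup>\<^bsub>X\<^esub> s" if "z \<in> carrier X" "s \<in> carrier S" for z s
    using that \<alpha>_ract[of "\<beta> z" s] \<alpha>\<beta>[of z] \<beta>\<alpha>[of "\<beta> z \<leftharpoonup>\<^bsub>X\<^esub> s"] by simp
  interpret g': balanced_pairing S K Y X "\<lambda>y x. g y (\<beta> x)"
    by unfold_locales
      (simp_all add: g.add_left g.add_right g.lact g.ract g.balanced \<beta>_add \<beta>_lact \<beta>_ract)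
  have "morita_context K S X Y f (\<lambda>y x. g y (\<beta> x))"
  proof
    \<comment> \<open>\<open>\<alpha>\<close> maps \<open>f a b \<rightharpoonup> \<beta> z\<close>
      to the right-hand side. By left linearity its argument is
      \<open>\<beta> (f a b \<rightharpoonup> z)\<close>, so the value is also the left-hand
      side.\<close>
    fix a b z assume "a \<in> carrier X" "b \<in> carrier Y" "z \<in> carrier X"
    then show "f a b \<rightharpoonup>\<^bsub>X\<^esub> z = a \<leftharpoonup>\<^bsub>X\<^esub> g b (\<beta> z)"
      using \<alpha>_pairing[of a b "\<beta> z"] \<beta>_lact[of z "f a b"] \<alpha>\<beta>[of "f a b \<rightharpoonup>\<^bsub>X\<^esub> z"] by simp
  qed
  \<comment> \<open>The corrected pairing applies \<open>\<beta>\<close> to its second argument, so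
    the decomposition of one survives with \<open>\<alpha> (x j)\<close> in place of
    \<open>x j\<close>.\<close>
  moreover have "(\<Oplus>\<^bsub>S\<^esub>j\<in>{..<n}. g (y j) (\<beta> (\<alpha> (x j)))) = \<one>\<^bsub>S\<^esub>"
    unfolding yx_one[symmetric] by (intro F.X.B.finsum_lessThan_cong) (auto simp: \<beta>\<alpha>)
  ultimately show ?thesis
    using \<open>n > 0\<close> uv uv_one yx by (intro that[where x = "\<lambda>j. \<alpha> (x j)" and n = n and N = N]) auto
qed

section \<open>Spans and matrices\<close>

context semiring
begin

section \<open>The two-sided ideal generated by one element and its closure under sums\<close>

lemma two_sided_span_closed:
  assumes "e \<in> carrier R" and "a \<in> two_sided_span R e"
  shows "a \<in> carrier R"
  using assms by (auto simp: two_sided_span_def Pi_def intro!: finsum_lessThan_closed)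

lemma zero_in_two_sided_span: "\<zero> \<in> two_sided_span R e"
  unfolding two_sided_span_def by (auto intro!: exI[of _ "0::nat"])

lemma term_add_in_two_sided_span:
  assumes e: "e \<in> carrier R" and rs: "r \<in> carrier R" "s \<in> carrier R"
    and a: "a \<in> two_sided_span R e"
  shows "r \<otimes> e \<otimes> s \<oplus> a \<in> two_sided_span R e"
proof -
  obtain m :: nat and r' s' where rs': "r' \<in> {..<m} \<rightarrow> carrier R" "s' \<in> {..<m} \<rightarrow> carrier R"
    and a: "a = (\<Oplus>i\<in>{..<m}. r' i \<otimes> e \<otimes> s' i)"
    using a by (auto simp: two_sided_span_def)
  let ?r = "r'(m := r)" and ?s = "s'(m := s)"
  have rs'': "?r \<in> {..<Suc m} \<rightarrow> carrier R" "?s \<in> {..<Suc m} \<rightarrow> carrier R"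
    using rs rs' by (auto simp: Pi_def less_Suc_eq)
  have "(\<Oplus>i\<in>{..<Suc m}. ?r i \<otimes> e \<otimes> ?s i) = ?r m \<otimes> e \<otimes> ?s m \<oplus> (\<Oplus>i\<in>{..<m}. ?r i \<otimes> e \<otimes> ?s i)"
    using rs'' e by (intro finsum_lessThan_Suc) (auto simp del: fun_upd_apply)
  also have "(\<Oplus>i\<in>{..<m}. ?r i \<otimes> e \<otimes> ?s i) = a"
    unfolding a using rs' e by (intro finsum_lessThan_cong) auto
  finally have "r \<otimes> e \<otimes> s \<oplus> a = (\<Oplus>i\<in>{..<Suc m}. ?r i \<otimes> e \<otimes> ?s i)" by simp
  with rs'' show ?thesis unfolding two_sided_span_def by blast
qed

lemma add_in_two_sided_span:
  assumes e: "e \<in> carrier R" and a: "a \<in> two_sided_span R e" and b: "b \<in> two_sided_span R e"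
  shows "a \<oplus> b \<in> two_sided_span R e"
proof -
  have b': "b \<in> carrier R" using e b by (rule two_sided_span_closed)
  have "(\<Oplus>i\<in>{..<m}. r i \<otimes> e \<otimes> s i) \<oplus> b \<in> two_sided_span R e"
    if "r \<in> {..<m} \<rightarrow> carrier R" "s \<in> {..<m} \<rightarrow> carrier R" for m :: nat and r s
    using that
  proof (induction m)
    case 0 then show ?case using b b' by simp
  next
    case (Suc m)
    then have rs: "\<And>i. i < Suc m \<Longrightarrow> r i \<in> carrier R" "\<And>i. i < Suc m \<Longrightarrow> s i \<in> carrier R" by auto
    have "(\<Oplus>i\<in>{..<Suc m}. r i \<otimes> e \<otimes> s i) \<oplus> b =
        r m \<otimes> e \<otimes> s m \<oplus> ((\<Oplus>i\<in>{..<m}. r i \<otimes> e \<otimes> s i) \<oplus> b)"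
      using rs e b' by (subst finsum_lessThan_Suc) (auto simp: a_assoc finsum_lessThan_closed)
    also have "\<dots> \<in> two_sided_span R e"
      using rs e Suc.IH by (intro term_add_in_two_sided_span) auto
    finally show ?case .
  qed
  with a show ?thesis by (auto simp: two_sided_span_def)
qed

lemma finsum_in_two_sided_span:
  assumes "e \<in> carrier R" and "finite I" and "\<And>i. i \<in> I \<Longrightarrow> F i \<in> two_sided_span R e"
  shows "finsum R F I \<in> two_sided_span R e"
  using assms(2,3)
proof (induction I)
  case empty then show ?case by (simp add: zero_in_two_sided_span)
next
  case (insert i I)
  have "F j \<in> carrier R" if "j \<in> insert i I" for j
    using insert.prems that assms(1) two_sided_span_closed by blast
  then have "finsum R F (insert i I) = F i \<oplus> finsum R F I"
    using insert.hyps by (intro finsum_insert) auto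
  with insert assms(1) show ?case by (auto intro: add_in_two_sided_span)
qed

section \<open>Matrices over a semiring, entry by entry\<close>

lemma carrier_mat_semiring:
  "P \<in> carrier (mat_semiring R n) \<longleftrightarrow>
    P \<in> carrier_mat n n \<and> (\<forall>i<n. \<forall>j<n. P $$ (i, j) \<in> carrier R)"
  by (simp add: mat_semiring_def)

lemma mat_semiring_eqI:
  assumes "P \<in> carrier (mat_semiring R n)" "Q \<in> carrier (mat_semiring R n)"
    and "\<And>i j. i < n \<Longrightarrow> j < n \<Longrightarrow> P $$ (i, j) = Q $$ (i, j)"
  shows "P = Q"
  using assms by (intro eq_matI) (auto simp: carrier_mat_semiring)

lemma index_mult_mat_semiring:
  "i < n \<Longrightarrow> j < n \<Longrightarrow>
    (P \<otimes>\<^bsub>mat_semiring R n\<^esub> Q) $$ (i, j) = (\<Oplus>k\<in>{..<n}. P $$ (i, k) \<otimes> Q $$ (k, j))"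
  by (simp add: mat_semiring_def)

lemma index_add_mat_semiring:
  "i < n \<Longrightarrow> j < n \<Longrightarrow> (P \<oplus>\<^bsub>mat_semiring R n\<^esub> Q) $$ (i, j) = P $$ (i, j) \<oplus> Q $$ (i, j)"
  by (simp add: mat_semiring_def)

lemma index_finsum_mat_semiring:
  assumes "finite I" and "\<And>l. l \<in> I \<Longrightarrow> F l \<in> carrier (mat_semiring R n)" and "i < n" "j < n"
  shows "(finsum (mat_semiring R n) F I) $$ (i, j) = (\<Oplus>l\<in>I. F l $$ (i, j))"
proof -
  interpret M: semiring "mat_semiring R n"
    by (rule semiring_mat_semiring) (rule semiring_axioms)
  show ?thesis
    using assms
    by (intro finsum_additive[where h = "\<lambda>P. P $$ (i, j)"])
      (auto simp: M.abelian_monoid_axioms abelian_monoid_axioms carrier_mat_semiring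
        index_add_mat_semiring, auto simp: mat_semiring_def)
qed

end

section \<open>The corner of a Morita context\<close>

locale finite_morita_context = morita_context K S X Y f g
  for K :: "('k, 'm) ring_scheme" and S :: "('s, 'n) ring_scheme"
    and X :: "('k, 's, 'x, 'p) bimodule_scheme" and Y :: "('s, 'k, 'y, 'q) bimodule_scheme"
    and f :: "'x \<Rightarrow> 'y \<Rightarrow> 'k" and g :: "'y \<Rightarrow> 'x \<Rightarrow> 's" +
  fixes n :: nat and x :: "nat \<Rightarrow> 'x" and y :: "nat \<Rightarrow> 'y"
  assumes x: "i < n \<Longrightarrow> x i \<in> carrier X" and y: "i < n \<Longrightarrow> y i \<in> carrier Y"
    and one: "(\<Oplus>\<^bsub>S\<^esub>i\<in>{..<n}. g (y i) (x i)) = \<one>\<^bsub>S\<^esub>"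
begin

lemmas closed [simp] = x y f.closed g.closed f.X.lact_closed f.X.ract_closed
  f.Y.lact_closed f.Y.ract_closed

sublocale M: semiring "mat_semiring K n"
  by (rule semiring_mat_semiring) (rule f.X.A.semiring_axioms)

text \<open>Expand one in \<open>z \<leftharpoonup> \<one>\<close> by \<open>one\<close> and move
  each \<open>g (y j) (x j)\<close> across with \<open>compat\<close>. The coordinates
  \<open>f z (y j)\<close> are linear in \<open>z\<close>, so \<open>X\<close> is a retract of a
  free left module of rank \<open>n\<close>.\<close>

lemma dual_basis:
  assumes "z \<in> carrier X"
  shows "(\<Oplus>\<^bsub>X\<^esub>j\<in>{..<n}. f z (y j) \<rightharpoonup>\<^bsub>X\<^esub> x j) = z"
proof -
  have "(\<Oplus>\<^bsub>X\<^esub>j\<in>{..<n}. f z (y j) \<rightharpoonup>\<^bsub>X\<^esub> x j) = (\<Oplus>\<^bsub>X\<^esub>j\<in>{..<n}. z \<leftharpoonup>\<^bsub>X\<^esub> g (y j) (x j))"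
    using assms by (intro f.X.X.finsum_lessThan_cong) (auto simp: compat)
  also have "\<dots> = z"
    using assms by (subst f.X.ract_finsum[symmetric]) (auto simp: one f.X.ract_one)
  finally show ?thesis .
qed

text \<open>Pair the dual basis expansion of \<open>z\<close> with \<open>w\<close>.
  Multiplicativity of \<open>mat_rep\<close> and fullness of its value at one both rest on this
  identity.\<close>

lemma dual_basis_pairing:
  assumes z: "z \<in> carrier X" and w: "w \<in> carrier Y"
  shows "(\<Oplus>\<^bsub>K\<^esub>j\<in>{..<n}. f z (y j) \<otimes>\<^bsub>K\<^esub> f (x j) w) = f z w"
proof -
  have "f z w = f (\<Oplus>\<^bsub>X\<^esub>j\<in>{..<n}. f z (y j) \<rightharpoonup>\<^bsub>X\<^esub> x j) w"
    using z by (simp add: dual_basis)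
  also have "\<dots> = (\<Oplus>\<^bsub>K\<^esub>j\<in>{..<n}. f (f z (y j) \<rightharpoonup>\<^bsub>X\<^esub> x j) w)"
    using z w by (intro f.finsum_left) auto
  also have "\<dots> = (\<Oplus>\<^bsub>K\<^esub>j\<in>{..<n}. f z (y j) \<otimes>\<^bsub>K\<^esub> f (x j) w)"
    using z w by (intro f.X.A.finsum_lessThan_cong) (auto simp: f.lact)
  finally show ?thesis by simp
qed

text \<open>Row \<open>i\<close> holds the coordinates of \<open>x i \<leftharpoonup> s\<close>.
  With coordinates in rows and \<open>s\<close> acting on the right, products keep their
  order.\<close>

definition mat_rep :: "'s \<Rightarrow> 'k mat" where
  "mat_rep s = mat n n (\<lambda>(i, j). f (x i \<leftharpoonup>\<^bsub>X\<^esub> s) (y j))"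

lemma mat_rep_closed [simp]: "s \<in> carrier S \<Longrightarrow> mat_rep s \<in> carrier (mat_semiring K n)"
  by (simp add: mat_rep_def f.X.A.carrier_mat_semiring)

lemma index_mat_rep: "i < n \<Longrightarrow> j < n \<Longrightarrow> mat_rep s $$ (i, j) = f (x i \<leftharpoonup>\<^bsub>X\<^esub> s) (y j)"
  by (simp add: mat_rep_def)

lemma mat_rep_add:
  assumes "s \<in> carrier S" "t \<in> carrier S"
  shows "mat_rep (s \<oplus>\<^bsub>S\<^esub> t) = mat_rep s \<oplus>\<^bsub>mat_semiring K n\<^esub> mat_rep t"
  using assms
  by (intro f.X.A.mat_semiring_eqI)
    (auto simp: index_mat_rep f.X.A.index_add_mat_semiring f.X.ract_add_right f.add_left)

text \<open>Balancing moves \<open>t\<close> from \<open>x k\<close> to \<open>y j\<close>, after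
  which the sum over \<open>k\<close> collapses by \<open>dual_basis_pairing\<close>.\<close>

lemma mat_rep_mult:
  assumes s: "s \<in> carrier S" and t: "t \<in> carrier S"
  shows "mat_rep (s \<otimes>\<^bsub>S\<^esub> t) = mat_rep s \<otimes>\<^bsub>mat_semiring K n\<^esub> mat_rep t"
proof (rule f.X.A.mat_semiring_eqI)
  fix i j assume ij: "i < n" "j < n"
  have "(mat_rep s \<otimes>\<^bsub>mat_semiring K n\<^esub> mat_rep t) $$ (i, j) =
      (\<Oplus>\<^bsub>K\<^esub>k\<in>{..<n}. f (x i \<leftharpoonup>\<^bsub>X\<^esub> s) (y k) \<otimes>\<^bsub>K\<^esub> f (x k) (t \<rightharpoonup>\<^bsub>Y\<^esub> y j))"
    unfolding f.X.A.index_mult_mat_semiring[OF ij] using ij s t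
    by (intro f.X.A.finsum_lessThan_cong) (auto simp: index_mat_rep f.balanced)
  also have "\<dots> = mat_rep (s \<otimes>\<^bsub>S\<^esub> t) $$ (i, j)"
    using ij s t by (simp add: dual_basis_pairing index_mat_rep f.balanced[symmetric] f.X.ract_mult)
  finally show "mat_rep (s \<otimes>\<^bsub>S\<^esub> t) $$ (i, j) = (mat_rep s \<otimes>\<^bsub>mat_semiring K n\<^esub> mat_rep t) $$ (i, j)" ..
qed (use s t in auto)

lemma mult_idempotent_mat_rep_one: "mult_idempotent (mat_semiring K n) (mat_rep \<one>\<^bsub>S\<^esub>)"
  by (simp add: mult_idempotent_def mat_rep_mult[symmetric])

text \<open>Idempotence makes the corner the set of matrices fixed by multiplication with the
  idempotent on either side. Surjectivity below uses the two fixed-point equations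
  separately.\<close>

lemma carrier_corner:
  "P \<in> carrier (corner (mat_semiring K n) (mat_rep \<one>\<^bsub>S\<^esub>)) \<longleftrightarrow> P \<in> carrier (mat_semiring K n) \<and>
    mat_rep \<one>\<^bsub>S\<^esub> \<otimes>\<^bsub>mat_semiring K n\<^esub> P = P \<and> P \<otimes>\<^bsub>mat_semiring K n\<^esub> mat_rep \<one>\<^bsub>S\<^esub> = P"
  (is "_ \<longleftrightarrow> ?R")
proof
  let ?e = "mat_rep \<one>\<^bsub>S\<^esub>"
  have ee: "?e \<otimes>\<^bsub>mat_semiring K n\<^esub> ?e = ?e"
    using mult_idempotent_mat_rep_one by (simp add: mult_idempotent_def)
  show ?R if corner: "P \<in> carrier (corner (mat_semiring K n) ?e)"
  proof -
    obtain Q where Q: "Q \<in> carrier (mat_semiring K n)"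
      and P: "P = ?e \<otimes>\<^bsub>mat_semiring K n\<^esub> Q \<otimes>\<^bsub>mat_semiring K n\<^esub> ?e"
      using corner by (auto simp: corner_def)
    have "?e \<otimes>\<^bsub>mat_semiring K n\<^esub> P = (?e \<otimes>\<^bsub>mat_semiring K n\<^esub> ?e) \<otimes>\<^bsub>mat_semiring K n\<^esub> Q \<otimes>\<^bsub>mat_semiring K n\<^esub> ?e"
      unfolding P using Q by (simp add: M.m_assoc)
    moreover have "P \<otimes>\<^bsub>mat_semiring K n\<^esub> ?e = P"
      unfolding P using Q by (simp add: M.m_assoc ee)
    ultimately show ?thesis unfolding ee P[symmetric] using Q by (simp add: P)
  qed
  show "P \<in> carrier (corner (mat_semiring K n) ?e)" if ?R
    using that by (auto simp: corner_def intro!: exI[of _ P])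
qed

text \<open>The rows of \<open>mat_rep s\<close> determine every
  \<open>x i \<leftharpoonup> s\<close> by \<open>dual_basis\<close>, and these determine
  \<open>s\<close> because multiplying \<open>one\<close> by \<open>s\<close> gives \<open>s\<close>
  as the sum of the \<open>g (y i) (x i \<leftharpoonup> s)\<close>.\<close>

lemma mat_rep_inj: "inj_on mat_rep (carrier S)"
proof (rule inj_onI)
  fix s t assume s: "s \<in> carrier S" and t: "t \<in> carrier S" and eq: "mat_rep s = mat_rep t"
  have eq': "x i \<leftharpoonup>\<^bsub>X\<^esub> s = x i \<leftharpoonup>\<^bsub>X\<^esub> t" if i: "i < n" for i
  proof -
    have "f (x i \<leftharpoonup>\<^bsub>X\<^esub> s) (y j) = f (x i \<leftharpoonup>\<^bsub>X\<^esub> t) (y j)" if "j < n" for j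
      using eq i that by (metis index_mat_rep)
    then have "(\<Oplus>\<^bsub>X\<^esub>j\<in>{..<n}. f (x i \<leftharpoonup>\<^bsub>X\<^esub> s) (y j) \<rightharpoonup>\<^bsub>X\<^esub> x j) = (\<Oplus>\<^bsub>X\<^esub>j\<in>{..<n}. f (x i \<leftharpoonup>\<^bsub>X\<^esub> t) (y j) \<rightharpoonup>\<^bsub>X\<^esub> x j)"
      using i t by (intro f.X.X.finsum_lessThan_cong) auto
    then show ?thesis using s t i by (simp add: dual_basis)
  qed
  have expand: "r = (\<Oplus>\<^bsub>S\<^esub>i\<in>{..<n}. g (y i) (x i \<leftharpoonup>\<^bsub>X\<^esub> r))" if r: "r \<in> carrier S" for r
  proof -
    have "(\<Oplus>\<^bsub>S\<^esub>i\<in>{..<n}. g (y i) (x i \<leftharpoonup>\<^bsub>X\<^esub> r)) = (\<Oplus>\<^bsub>S\<^esub>i\<in>{..<n}. g (y i) (x i) \<otimes>\<^bsub>S\<^esub> r)"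
      using r by (intro f.X.B.finsum_lessThan_cong) (auto simp: g.ract)
    also have "\<dots> = r"
      using r by (subst f.X.B.finsum_ldistr[symmetric]) (auto simp: one)
    finally show ?thesis ..
  qed
  have "s = (\<Oplus>\<^bsub>S\<^esub>i\<in>{..<n}. g (y i) (x i \<leftharpoonup>\<^bsub>X\<^esub> s))" by (rule expand[OF s])
  also have "\<dots> = (\<Oplus>\<^bsub>S\<^esub>i\<in>{..<n}. g (y i) (x i \<leftharpoonup>\<^bsub>X\<^esub> t))"
    using t by (intro f.X.B.finsum_lessThan_cong) (auto simp: eq')
  also have "\<dots> = t" by (rule expand[OF t, symmetric])
  finally show "s = t" .
qed

lemma mat_rep_surj:
  assumes "P \<in> carrier (corner (mat_semiring K n) (mat_rep \<one>\<^bsub>S\<^esub>))"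
  shows "P \<in> mat_rep ` carrier S"
proof
  let ?M = "mat_semiring K n" and ?e = "mat_rep \<one>\<^bsub>S\<^esub>"
  have P: "P \<in> carrier ?M" and eP: "?e \<otimes>\<^bsub>?M\<^esub> P = P" and Pe: "P \<otimes>\<^bsub>?M\<^esub> ?e = P"
    using assms by (simp_all add: carrier_corner)
  have [simp]: "P $$ (i, j) \<in> carrier K" if "i < n" "j < n" for i j
    using P that by (simp add: f.X.A.carrier_mat_semiring)
  have e: "?e $$ (i, j) = f (x i) (y j)" if "i < n" "j < n" for i j
    using that by (simp add: index_mat_rep f.X.ract_one)
  \<comment> \<open>\<open>z i\<close> is the element of \<open>X\<close> built from row
    \<open>i\<close> of \<open>P\<close>; it is to become \<open>x i \<leftharpoonup> s\<close>. The
    equation \<open>Pe\<close> ensures that its coordinates are again row \<open>i\<close>.\<close>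
  define z where "z i = (\<Oplus>\<^bsub>X\<^esub>j\<in>{..<n}. P $$ (i, j) \<rightharpoonup>\<^bsub>X\<^esub> x j)" for i
  have z [simp]: "z i \<in> carrier X" if "i < n" for i
    unfolding z_def using that by (intro f.X.X.finsum_lessThan_closed) simp
  have fz: "f (z i) (y l) = P $$ (i, l)" if il: "i < n" "l < n" for i l
  proof -
    have "f (z i) (y l) = (\<Oplus>\<^bsub>K\<^esub>j\<in>{..<n}. f (P $$ (i, j) \<rightharpoonup>\<^bsub>X\<^esub> x j) (y l))"
      unfolding z_def using il by (intro f.finsum_left) auto
    also have "\<dots> = (\<Oplus>\<^bsub>K\<^esub>j\<in>{..<n}. P $$ (i, j) \<otimes>\<^bsub>K\<^esub> ?e $$ (j, l))"
      using il by (intro f.X.A.finsum_lessThan_cong) (auto simp: f.lact e)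
    also have "\<dots> = (P \<otimes>\<^bsub>?M\<^esub> ?e) $$ (i, l)"
      using il by (simp add: f.X.A.index_mult_mat_semiring)
    finally show ?thesis by (simp add: Pe)
  qed
  \<comment> \<open>The injectivity argument recovers a preimage from the elements
    \<open>x i \<leftharpoonup> s\<close>, so this is the only candidate.\<close>
  define s where "s = (\<Oplus>\<^bsub>S\<^esub>i\<in>{..<n}. g (y i) (z i))"
  show s: "s \<in> carrier S"
    unfolding s_def by (intro f.X.B.finsum_lessThan_closed) simp
  show "P = mat_rep s"
  proof (rule f.X.A.mat_semiring_eqI)
    fix k l assume kl: "k < n" "l < n"
    \<comment> \<open>Through \<open>compat\<close> the entries of \<open>mat_rep s\<close> become
      those of the product of \<open>?e\<close> and \<open>P\<close>, which \<open>eP\<close>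
      identifies with \<open>P\<close>.\<close>
    have "x k \<leftharpoonup>\<^bsub>X\<^esub> s = (\<Oplus>\<^bsub>X\<^esub>i\<in>{..<n}. x k \<leftharpoonup>\<^bsub>X\<^esub> g (y i) (z i))"
      unfolding s_def using kl by (intro f.X.ract_finsum) auto
    also have "\<dots> = (\<Oplus>\<^bsub>X\<^esub>i\<in>{..<n}. f (x k) (y i) \<rightharpoonup>\<^bsub>X\<^esub> z i)"
      using kl by (intro f.X.X.finsum_lessThan_cong) (auto simp: compat)
    finally have "mat_rep s $$ (k, l) = f (\<Oplus>\<^bsub>X\<^esub>i\<in>{..<n}. f (x k) (y i) \<rightharpoonup>\<^bsub>X\<^esub> z i) (y l)"
      using kl by (simp add: index_mat_rep)
    also have "\<dots> = (\<Oplus>\<^bsub>K\<^esub>i\<in>{..<n}. f (f (x k) (y i) \<rightharpoonup>\<^bsub>X\<^esub> z i) (y l))"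
      using kl by (intro f.finsum_left) auto
    also have "\<dots> = (\<Oplus>\<^bsub>K\<^esub>i\<in>{..<n}. ?e $$ (k, i) \<otimes>\<^bsub>K\<^esub> P $$ (i, l))"
      using kl by (intro f.X.A.finsum_lessThan_cong) (auto simp: f.lact e fz)
    also have "\<dots> = (?e \<otimes>\<^bsub>?M\<^esub> P) $$ (k, l)"
      using kl by (simp add: f.X.A.index_mult_mat_semiring)
    finally show "P $$ (k, l) = mat_rep s $$ (k, l)" by (simp add: eP)
  qed (use P s in auto)
qed

text \<open>The idempotent is the image of one, so multiplicativity places the image of
  \<open>mat_rep\<close> in the corner and the units correspond.\<close>

lemma ring_iso_corner: "S \<simeq> corner (mat_semiring K n) (mat_rep \<one>\<^bsub>S\<^esub>)"
proof -
  let ?C = "corner (mat_semiring K n) (mat_rep \<one>\<^bsub>S\<^esub>)"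
  have closed: "mat_rep s \<in> carrier ?C" if "s \<in> carrier S" for s
    using that by (simp add: carrier_corner mat_rep_mult[symmetric])
  then have "mat_rep ` carrier S = carrier ?C" using mat_rep_surj by blast
  then have "bij_betw mat_rep (carrier S) (carrier ?C)"
    using mat_rep_inj by (simp add: bij_betw_def)
  moreover have "mat_rep \<in> Ring.ring_hom S ?C"
    using closed by (intro ring_hom_memI) (auto simp: corner_def mat_rep_mult mat_rep_add)
  ultimately show ?thesis by (auto simp: is_ring_iso_def ring_iso_def)
qed

text \<open>Multiplying an entry of \<open>P\<close> by the decomposition \<open>uv_one\<close>
  makes it a sum of terms \<open>f (u i) (v i \<leftharpoonup> P $$ (p, c))\<close>. By
  \<open>dual_basis_pairing\<close> each term factors through the dual basis, hence through the
  idempotent.\<close>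

lemma full_element_mat_rep_one:
  fixes N :: nat
  assumes uv: "\<And>i. i < N \<Longrightarrow> u i \<in> carrier X" "\<And>i. i < N \<Longrightarrow> v i \<in> carrier Y"
    and uv_one: "(\<Oplus>\<^bsub>K\<^esub>i\<in>{..<N}. f (u i) (v i)) = \<one>\<^bsub>K\<^esub>"
  shows "full_element (mat_semiring K n) (mat_rep \<one>\<^bsub>S\<^esub>)"
proof -
  let ?M = "mat_semiring K n" and ?e = "mat_rep \<one>\<^bsub>S\<^esub>"
  note [simp] = uv
  have e: "?e $$ (i, j) = f (x i) (y j)" if "i < n" "j < n" for i j
    using that by (simp add: index_mat_rep f.X.ract_one)
  have e_closed: "?e \<in> carrier ?M" by simp
  have "P \<in> two_sided_span ?M ?e" if P: "P \<in> carrier ?M" for P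
  proof -
    have [simp]: "P $$ (i, j) \<in> carrier K" if "i < n" "j < n" for i j
      using P that by (simp add: f.X.A.carrier_mat_semiring)
    \<comment> \<open>\<open>L p i\<close> carries the coordinates of \<open>u i\<close> in row
      \<open>p\<close> and is zero elsewhere; \<open>R p i\<close> pairs the generators with the
      multiples of \<open>v i\<close> by the entries in row \<open>p\<close> of
      \<open>P\<close>.\<close>
    define L where "L p i = mat n n (\<lambda>(a, b). if a = p then f (u i) (y b) else \<zero>\<^bsub>K\<^esub>)" for p i
    define R where "R p i = mat n n (\<lambda>(b, c). f (x b) (v i \<leftharpoonup>\<^bsub>Y\<^esub> P $$ (p, c)))" for p i
    have LR [simp]: "L p i \<in> carrier ?M" "R p i \<in> carrier ?M" if "p < n" "i < N" for p i
      using that by (auto simp: L_def R_def f.X.A.carrier_mat_semiring)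
    \<comment> \<open>Each column of \<open>R p i\<close> consists of the values
      \<open>f (x b) w\<close> for a fixed \<open>w\<close>, and \<open>?e\<close> fixes such
      columns by \<open>dual_basis_pairing\<close>.\<close>
    have eR: "?e \<otimes>\<^bsub>?M\<^esub> R p i = R p i" if pi: "p < n" "i < N" for p i
    proof (rule f.X.A.mat_semiring_eqI)
      fix a c assume ac: "a < n" "c < n"
      have "(?e \<otimes>\<^bsub>?M\<^esub> R p i) $$ (a, c) =
          (\<Oplus>\<^bsub>K\<^esub>k\<in>{..<n}. f (x a) (y k) \<otimes>\<^bsub>K\<^esub> f (x k) (v i \<leftharpoonup>\<^bsub>Y\<^esub> P $$ (p, c)))"
        unfolding f.X.A.index_mult_mat_semiring[OF ac] using ac pi
        by (intro f.X.A.finsum_lessThan_cong) (auto simp: e R_def)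
      also have "\<dots> = R p i $$ (a, c)"
        using ac pi by (simp add: dual_basis_pairing R_def)
      finally show "(?e \<otimes>\<^bsub>?M\<^esub> R p i) $$ (a, c) = R p i $$ (a, c)" .
    qed (use pi in auto)
    have LeR: "(L p i \<otimes>\<^bsub>?M\<^esub> ?e \<otimes>\<^bsub>?M\<^esub> R p i) $$ (a, c) =
        (if p = a then f (u i) (v i) \<otimes>\<^bsub>K\<^esub> P $$ (p, c) else \<zero>\<^bsub>K\<^esub>)"
      if pi: "p < n" "i < N" and ac: "a < n" "c < n" for p i a c
    proof -
      have "(L p i \<otimes>\<^bsub>?M\<^esub> ?e \<otimes>\<^bsub>?M\<^esub> R p i) $$ (a, c) = (L p i \<otimes>\<^bsub>?M\<^esub> R p i) $$ (a, c)"
        using pi by (simp add: M.m_assoc eR)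
      also have "\<dots> = (if p = a then (\<Oplus>\<^bsub>K\<^esub>k\<in>{..<n}. f (u i) (y k) \<otimes>\<^bsub>K\<^esub> f (x k) (v i \<leftharpoonup>\<^bsub>Y\<^esub> P $$ (p, c)))
          else (\<Oplus>\<^bsub>K\<^esub>k\<in>{..<n}. \<zero>\<^bsub>K\<^esub>))"
        unfolding f.X.A.index_mult_mat_semiring[OF ac] using ac pi
        by (auto simp: L_def R_def intro!: f.X.A.finsum_lessThan_cong simp del: f.X.A.finsum_zero)
      also have "\<dots> = (if p = a then f (u i) (v i) \<otimes>\<^bsub>K\<^esub> P $$ (p, c) else \<zero>\<^bsub>K\<^esub>)"
        using ac pi by (simp add: dual_basis_pairing f.ract)
      finally show ?thesis .
    qed
    \<comment> \<open>The inner sum over \<open>i\<close> rebuilds row \<open>p\<close> of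
      \<open>P\<close> by \<open>uv_one\<close>; the outer sum assembles the rows.\<close>
    have P_eq: "P = (\<Oplus>\<^bsub>?M\<^esub>p\<in>{..<n}. \<Oplus>\<^bsub>?M\<^esub>i\<in>{..<N}. L p i \<otimes>\<^bsub>?M\<^esub> ?e \<otimes>\<^bsub>?M\<^esub> R p i)"
    proof (rule f.X.A.mat_semiring_eqI[OF P])
      show "(\<Oplus>\<^bsub>?M\<^esub>p\<in>{..<n}. \<Oplus>\<^bsub>?M\<^esub>i\<in>{..<N}. L p i \<otimes>\<^bsub>?M\<^esub> ?e \<otimes>\<^bsub>?M\<^esub> R p i) \<in> carrier ?M"
        by (intro M.finsum_lessThan_closed) simp
      fix a c assume ac: "a < n" "c < n"
      have "(\<Oplus>\<^bsub>?M\<^esub>p\<in>{..<n}. \<Oplus>\<^bsub>?M\<^esub>i\<in>{..<N}. L p i \<otimes>\<^bsub>?M\<^esub> ?e \<otimes>\<^bsub>?M\<^esub> R p i) $$ (a, c) =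
          (\<Oplus>\<^bsub>K\<^esub>p\<in>{..<n}. (\<Oplus>\<^bsub>?M\<^esub>i\<in>{..<N}. L p i \<otimes>\<^bsub>?M\<^esub> ?e \<otimes>\<^bsub>?M\<^esub> R p i) $$ (a, c))"
        using ac by (intro f.X.A.index_finsum_mat_semiring M.finsum_lessThan_closed) auto
      \<comment> \<open>The test is oriented as \<open>a = p\<close> to match
        \<open>finsum_singleton\<close>, which then selects row \<open>a\<close>.\<close>
      also have "\<dots> = (\<Oplus>\<^bsub>K\<^esub>p\<in>{..<n}. if a = p then P $$ (p, c) else \<zero>\<^bsub>K\<^esub>)"
      proof (rule f.X.A.finsum_lessThan_cong)
        fix p assume p: "p < n"
        have "(\<Oplus>\<^bsub>?M\<^esub>i\<in>{..<N}. L p i \<otimes>\<^bsub>?M\<^esub> ?e \<otimes>\<^bsub>?M\<^esub> R p i) $$ (a, c) =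
            (\<Oplus>\<^bsub>K\<^esub>i\<in>{..<N}. (L p i \<otimes>\<^bsub>?M\<^esub> ?e \<otimes>\<^bsub>?M\<^esub> R p i) $$ (a, c))"
          using ac p by (intro f.X.A.index_finsum_mat_semiring) auto
        also have "\<dots> = (\<Oplus>\<^bsub>K\<^esub>i\<in>{..<N}. if p = a then f (u i) (v i) \<otimes>\<^bsub>K\<^esub> P $$ (p, c) else \<zero>\<^bsub>K\<^esub>)"
          using ac p by (intro f.X.A.finsum_lessThan_cong) (auto simp: LeR)
        also have "\<dots> = (if a = p then P $$ (p, c) else \<zero>\<^bsub>K\<^esub>)"
        proof (cases "p = a")
          case True
          have "(\<Oplus>\<^bsub>K\<^esub>i\<in>{..<N}. f (u i) (v i) \<otimes>\<^bsub>K\<^esub> P $$ (p, c)) = P $$ (p, c)"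
            using ac p by (subst f.X.A.finsum_ldistr[symmetric]) (auto simp: uv_one)
          with True show ?thesis by simp
        qed simp
        finally show "(\<Oplus>\<^bsub>?M\<^esub>i\<in>{..<N}. L p i \<otimes>\<^bsub>?M\<^esub> ?e \<otimes>\<^bsub>?M\<^esub> R p i) $$ (a, c) =
          (if a = p then P $$ (p, c) else \<zero>\<^bsub>K\<^esub>)" .
      qed (use ac in auto)
      also have "\<dots> = P $$ (a, c)"
        using ac by (intro f.X.A.finsum_singleton) auto
      finally show "P $$ (a, c) = (\<Oplus>\<^bsub>?M\<^esub>p\<in>{..<n}. \<Oplus>\<^bsub>?M\<^esub>i\<in>{..<N}. L p i \<otimes>\<^bsub>?M\<^esub> ?e \<otimes>\<^bsub>?M\<^esub> R p i) $$ (a, c)" ..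
    qed
    \<comment> \<open>A single product lies in the span as that product plus the zero
      matrix.\<close>
    have "L p i \<otimes>\<^bsub>?M\<^esub> ?e \<otimes>\<^bsub>?M\<^esub> R p i \<in> two_sided_span ?M ?e" if "p < n" "i < N" for p i
      using that M.term_add_in_two_sided_span[OF e_closed, of "L p i" "R p i" "\<zero>\<^bsub>?M\<^esub>"]
      by (simp add: M.zero_in_two_sided_span)
    then show ?thesis
      by (subst P_eq) (auto intro!: M.finsum_in_two_sided_span)
  qed
  then show ?thesis
    using M.two_sided_span_closed[OF e_closed] by (auto simp: full_element_def)
qed

end

section \<open>From the two tensor isomorphisms to a full corner of a matrix semiring\<close>

theorem mainTheorem4:
  fixes K :: "('k, 'm) kleene_scheme" and S :: "('s, 'n) kleene_scheme"
    and X :: "('k, 's, 'x, 'p) bimodule_scheme" and Y :: "('s, 'k, 'y, 'q) bimodule_scheme"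
  assumes "kleene_algebra K" and "kleene_algebra S"
    and "kleene_morita_equivalence_by K S X Y"
  shows "\<exists>(n::nat) e. n > 0 \<and> mult_idempotent (mat_semiring K n) e \<and>
    full_element (mat_semiring K n) e \<and> S \<simeq> corner (mat_semiring K n) e"
proof -
  have X: "semibimodule K S X" and Y: "semibimodule S K Y"
    using assms(3) by (auto simp: kleene_morita_equivalence_by_def kleene_bimodule_def)
  obtain h h' where "h \<in> bimodule_iso K K (tensor X S Y) (regular_bimodule K)"
    and "h' \<in> bimodule_iso S S (tensor Y K X) (regular_bimodule S)"
    using assms(3) by (auto simp: kleene_morita_equivalence_by_def)
  with X Y have "tensor_iso K S X Y h" "tensor_iso S K Y X h'"
    by (auto simp: tensor_iso_def tensor_iso_axioms_def)
  then obtain f g and n N :: nat and x y u v where "morita_context K S X Y f g" and "n > 0"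
    and "\<And>i. i < n \<Longrightarrow> x i \<in> carrier X" and "\<And>i. i < n \<Longrightarrow> y i \<in> carrier Y"
    and "(\<Oplus>\<^bsub>S\<^esub>i\<in>{..<n}. g (y i) (x i)) = \<one>\<^bsub>S\<^esub>"
    and uv: "\<And>i. i < N \<Longrightarrow> u i \<in> carrier X" "\<And>i. i < N \<Longrightarrow> v i \<in> carrier Y"
      "(\<Oplus>\<^bsub>K\<^esub>i\<in>{..<N}. f (u i) (v i)) = \<one>\<^bsub>K\<^esub>"
    by (rule morita_context_of_tensor_isos) blast
  \<comment> \<open>The decomposition of one in \<open>S\<close> fixes the size \<open>n\<close> and
    the matrix representation; the one in \<open>K\<close>, with families \<open>u\<close> and
    \<open>v\<close>, is kept for fullness.\<close>
  then interpret finite_morita_context K S X Y f g n x y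
    by (simp add: finite_morita_context_def finite_morita_context_axioms_def)
  show ?thesis
    using \<open>n > 0\<close> mult_idempotent_mat_rep_one full_element_mat_rep_one[OF uv] ring_iso_corner
    by blast
qed

end
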